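(* For each $\epsilon>0$ there exists $\delta=\delta(\epsilon)>0$ such that whenever $\beta>0$ and $\Delta\in(0,1)$ satisfy $(\beta J)\Delta^2\ge1/\delta$ and $(\beta J)\Delta^3\le\delta$, then $$\limsup_{L\to\infty}\bigl|F^{(\Delta)}_{L,\beta}(\theta^\star)-F(\theta^\star)\bigr|\le\epsilon\qquad\text{for all }\theta^\star\in[0,2\pi).$$
   Context: On the torus $\mathbb T_L=\mathbb Z^3/(L\mathbb Z)^3$, write spins as angles $\boldsymbol\theta=(\theta_{\boldsymbol r})$, $\boldsymbol S_{\boldsymbol r}=(\cos\theta_{\boldsymbol r},\sin\theta_{\boldsymbol r})$, and let $\mathscr H_L(\boldsymbol\theta)=\frac J2\sum_{\boldsymbol r\in\mathbb T_L}\bigl[(\cos\theta_{\boldsymbol r}-\cos\theta_{\boldsymbol r+\hat{\mathrm e}_1})^2+(\cos(\theta_{\boldsymbol r}-\tfrac{2\pi}3)-\cos(\theta_{\boldsymbol r+\hat{\mathrm e}_2}-\tfrac{2\pi}3))^2+(\cos(\theta_{\boldsymbol r}+\tfrac{2\pi}3)-\cos(\theta_{\boldsymbol r+\hat{\mathrm e}_3}+\tfrac{2\pi}3))^2\bigr]$, $J>0$. Let $\chi_{\Delta,L}(\boldsymbol\theta)$ be the indicator that $|\theta_{\boldsymbol r}-\theta^\star|<\Delta$ (difference mod $2\pi$) for all $\boldsymbol r\in\mathbb T_L$. Define $F^{(\Delta)}_{L,\beta}(\theta^\star)=-\frac12\log\frac{\beta J}{2\pi}-\frac1{L^3}\log\int_{[0,2\pi)^{\mathbb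 T_L}}e^{-\beta\mathscr H_L(\boldsymbol\theta)}\chi_{\Delta,L}(\boldsymbol\theta)\prod_{\boldsymbol r}d\theta_{\boldsymbol r}$. With $q_1=\sin^2\theta^\star$, $q_2=\sin^2(\theta^\star-\tfrac{2\pi}3)$, $q_3=\sin^2(\theta^\star+\tfrac{2\pi}3)$, define the spin-wave free energy $F(\theta^\star)=\frac12\int_{[-\pi,\pi]^3}\frac{d\boldsymbol k}{(2\pi)^3}\log\Bigl\{\sum_{\alpha=1}^3q_\alpha|1-e^{ik_\alpha}|^2\Bigr\}$. *)

theory Defs
  imports "HOL-Analysis.Analysis"
begin

text \<open>Sites of the torus T_L = Z^3/(LZ)^3, represented by triples with coordinates in {0..<L}.\<close>
definition torus :: "nat \<Rightarrow> (nat \<times> nat \<times> nat) set" where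
  "torus L = {0..<L} \<times> {0..<L} \<times> {0..<L}"

definition shift1 :: "nat \<Rightarrow> nat \<times> nat \<times> nat \<Rightarrow> nat \<times> nat \<times> nat" where
  "shift1 L r = (case r of (i, j, k) \<Rightarrow> ((i + 1) mod L, j, k))"
definition shift2 :: "nat \<Rightarrow> nat \<times> nat \<times> nat \<Rightarrow> nat \<times> nat \<times> nat" where
  "shift2 L r = (case r of (i, j, k) \<Rightarrow> (i, (j + 1) mod L, k))"
definition shift3 :: "nat \<Rightarrow> nat \<times> nat \<times> nat \<Rightarrow> nat \<times> nat \<times> nat" where
  "shift3 L r = (case r of (i, j, k) \<Rightarrow> (i, j, (k + 1) mod L))"

definition hamiltonian :: "real \<Rightarrow> nat \<Rightarrow> (nat \<times> nat \<times> nat \<Rightarrow> real) \<Rightarrow> real" where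
  "hamiltonian J L \<theta> = J / 2 * (\<Sum>r\<in>torus L.
      (cos (\<theta> r) - cos (\<theta> (shift1 L r)))\<^sup>2
    + (cos (\<theta> r - 2*pi/3) - cos (\<theta> (shift2 L r) - 2*pi/3))\<^sup>2
    + (cos (\<theta> r + 2*pi/3) - cos (\<theta> (shift3 L r) + 2*pi/3))\<^sup>2)"

definition chi :: "real \<Rightarrow> real \<Rightarrow> nat \<Rightarrow> (nat \<times> nat \<times> nat \<Rightarrow> real) \<Rightarrow> real" where
  "chi \<Delta> \<theta>s L \<theta> =
     (if \<forall>r\<in>torus L. \<exists>n::int. \<bar>\<theta> r - \<theta>s - 2 * pi * of_int n\<bar> < \<Delta> then 1 else 0)"

definition config_measure :: "nat \<Rightarrow> (nat \<times> nat \<times> nat \<Rightarrow> real) measure" where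
  "config_measure L = PiM (torus L) (\<lambda>_. restrict_space lborel {0..<2*pi})"

definition restricted_free_energy ::
  "real \<Rightarrow> real \<Rightarrow> real \<Rightarrow> nat \<Rightarrow> real \<Rightarrow> real" where
  "restricted_free_energy J \<Delta> \<beta> L \<theta>s =
     - (1/2) * ln (\<beta> * J / (2*pi))
     - (1 / real L ^ 3) * ln (integral\<^sup>L (config_measure L)
          (\<lambda>\<theta>. exp (- \<beta> * hamiltonian J L \<theta>) * chi \<Delta> \<theta>s L \<theta>))"

definition spin_wave_free_energy :: "real \<Rightarrow> real" where
  "spin_wave_free_energy \<theta>s =
     (let q1 = (sin \<theta>s)\<^sup>2; q2 = (sin (\<theta>s - 2*pi/3))\<^sup>2; q3 = (sin (\<theta>s + 2*pi/3))\<^sup>2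
      in 1/2 * (LINT k : {-pi..pi} \<times> {-pi..pi} \<times> {-pi..pi} | lborel.
           ln (q1 * (cmod (1 - cis (fst k)))\<^sup>2 + q2 * (cmod (1 - cis (fst (snd k))))\<^sup>2
               + q3 * (cmod (1 - cis (snd (snd k))))\<^sup>2) / (2*pi)^3))"

end

theory Submission
  imports Defs "HOL-Probability.Distributions" "Jordan_Normal_Form.Determinant"
begin

text \<open>
  For angles within \<open>\<Delta>\<close> of \<open>\<theta>\<^sup>\<star>\<close>, replacing the Hamiltonian by its quadratic part costs \<open>O(\<beta> J \<Delta>\<^sup>3)\<close>
  per site in the exponent. The constraint \<open>\<bar>\<phi>\<^sub>r\<bar> < \<Delta>\<close> on the deviations is then traded for a mass term on both sides.
  From above, the indicator is at most \<open>exp (\<lambda> (\<Delta>\<^sup>2 - \<phi>\<^sub>r\<^sup>2) / 2)\<close>. From below, substitute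
  \<open>\<phi>\<^sub>r = h (\<eta>\<^sub>r)\<close> with \<open>h (x) = arctan (c x) / c\<close> and \<open>c = \<pi> / (2 \<Delta>)\<close>: since \<open>h\<close> is a contraction of the line
  onto \<open>(-\<Delta>, \<Delta>)\<close>, the gradient energy does not increase, and the Jacobian \<open>1 / (1 + (c x)\<^sup>2)\<close> is at least
  \<open>exp (- (c x)\<^sup>2)\<close>. Both bounds are massive Gaussian integrals, diagonalised by the real
  Fourier (Hartley) basis \<open>cos + sin\<close>; the logarithms of their eigenvalues form Riemann sums of
  \<open>ln (D (k) + m)\<close>, where \<open>m\<close> is of order \<open>1 / (\<beta> J \<Delta>\<^sup>2)\<close>. As \<open>m \<rightarrow> 0\<close> these integrals converge uniformly
  in \<open>\<theta>\<^sup>\<star>\<close>, because one of the three stiffnesses is always at least \<open>1/2\<close>, which makes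
  \<open>ln (1 + m / D (k))\<close> at most of order \<open>m\<^bsup>1/4\<^esup> \<bar>k\<^sub>\<alpha>\<bar>\<^bsup>-1/2\<^esup>\<close> for some coordinate \<open>\<alpha>\<close>.
\<close>

subsection \<open>Gaussian integrals over finite index sets\<close>

lemma nn_integral_gaussian:
  assumes "a > 0"
  shows "(\<integral>\<^sup>+y. ennreal (exp (- (1/2) * (a * (y + c)\<^sup>2))) \<partial>lborel) = ennreal (sqrt (2*pi/a))"
proof -
  have s: "1 / sqrt a > 0" using assms by simp
  have "exp (- (1/2) * (a * (y + c)\<^sup>2)) = sqrt (2*pi/a) * normal_density (-c) (1 / sqrt a) y" for y
    using assms by (simp add: normal_density_def power_divide field_simps)
  then have "(\<integral>\<^sup>+y. ennreal (exp (- (1/2) * (a * (y + c)\<^sup>2))) \<partial>lborel)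
      = (\<integral>\<^sup>+y. ennreal (sqrt (2*pi/a)) * ennreal (normal_density (-c) (1 / sqrt a) y) \<partial>lborel)"
    using assms by (simp add: ennreal_mult')
  also have "\<dots> = ennreal (sqrt (2*pi/a)) * (\<integral>\<^sup>+y. ennreal (normal_density (-c) (1 / sqrt a) y) \<partial>lborel)"
    by (rule nn_integral_cmult) simp
  also have "(\<integral>\<^sup>+y. ennreal (normal_density (-c) (1 / sqrt a) y) \<partial>lborel) = 1"
    using integral_normal_density[OF s, of "-c"] integrable_normal_density[OF s, of "-c"]
    by (subst nn_integral_eq_integral) (auto simp: normal_density_nonneg)
  finally show ?thesis by simp
qed

text \<open>Elimination of the last index: the matrix is the product of the block upper triangular
  \<open>X\<close>, with the Schur complement \<open>P\<close> and the pivot on its diagonal, and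
  the unit lower triangular \<open>Y\<close>, whose last row is the pivot row divided by the
  pivot.\<close>

lemma det_schur_complement:
  fixes A :: "nat \<Rightarrow> nat \<Rightarrow> real"
  assumes a: "A n n \<noteq> 0"
  shows "Determinant.det (Matrix.mat (Suc n) (Suc n) (\<lambda>(i,j). A i j))
       = A n n * Determinant.det (Matrix.mat n n (\<lambda>(i,j). A i j - A i n * A n j / A n n))"
proof -
  define A' where "A' = (\<lambda>i j. A i j - A i n * A n j / A n n)"
  define P where "P = Matrix.mat n n (\<lambda>(i,j). A' i j)"
  define B where "B = Matrix.mat n 1 (\<lambda>(i,j). A i n)"
  define D where "D = Matrix.mat 1 1 (\<lambda>(i,j). A n n)"
  define X where "X = four_block_mat P B (0\<^sub>m 1 n) D"
  define Y where "Y = Matrix.mat (Suc n) (Suc n)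
      (\<lambda>(i,j). if i < n then (if i = j then 1 else 0) else if j < n then A n j / A n n else 1)"
  have X: "X \<in> carrier_mat (Suc n) (Suc n)" and Y: "Y \<in> carrier_mat (Suc n) (Suc n)"
    by (auto simp: X_def Y_def P_def B_def D_def four_block_mat_def Let_def)
  have entX: "X $$ (i,k) = (if k < n then if i < n then A' i k else 0 else A i n)"
    if "i < Suc n" "k < Suc n" for i k
    using that by (auto simp: X_def P_def B_def D_def four_block_mat_def Let_def less_Suc_eq)
  have XY: "Matrix.mat (Suc n) (Suc n) (\<lambda>(i,j). A i j) = X * Y"
  proof (rule eq_matI)
    fix i j assume ij: "i < dim_row (X * Y)" "j < dim_col (X * Y)"
    then have i: "i < Suc n" and j: "j < Suc n" using X Y by auto
    have "(X * Y) $$ (i,j) = (\<Sum>k<Suc n. X $$ (i,k) * Y $$ (k,j))"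
      using X Y i j by (auto simp: times_mat_def scalar_prod_def lessThan_atLeast0)
    also have "\<dots> = (\<Sum>k<n. X $$ (i,k) * (if k = j then 1 else 0))
        + A i n * (if j < n then A n j / A n n else 1)"
      using i j by (auto simp: Y_def entX intro!: sum.cong)
    also have "(\<Sum>k<n. X $$ (i,k) * (if k = j then 1 else 0)) = (if j < n then X $$ (i,j) else 0)"
      by (simp add: if_distrib sum.delta cong: if_cong)
    also have "(if j < n then X $$ (i,j) else 0) + A i n * (if j < n then A n j / A n n else 1) = A i j"
      using i j a by (auto simp: entX A'_def less_Suc_eq)
    finally show "Matrix.mat (Suc n) (Suc n) (\<lambda>(i,j). A i j) $$ (i,j) = (X * Y) $$ (i,j)"
      using i j by simp
  qed (use X Y in auto)
  have detY: "Determinant.det Y = 1"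
  proof -
    have "Determinant.det Y = prod_list (diag_mat Y)"
      by (rule det_lower_triangular[OF _ Y]) (auto simp: Y_def)
    also have "\<dots> = (\<Prod>i\<in>{0..<Suc n}. Y $$ (i,i))"
      using Y by (simp add: prod_list_diag_prod)
    also have "\<dots> = 1" by (rule prod.neutral) (auto simp: Y_def)
    finally show ?thesis .
  qed
  have "Determinant.det X = Determinant.det P * Determinant.det D"
    unfolding X_def by (rule det_four_block_mat_lower_left_zero[of _ n _ 1])
      (auto simp: P_def B_def D_def)
  also have "Determinant.det D = A n n"
    by (subst det_single) (auto simp: D_def)
  finally show ?thesis
    by (simp add: XY det_mult[OF X Y] detY P_def A'_def mult.commute)
qed

text \<open>Completing the square in \<open>x z\<close>. What remains on \<open>I\<close> is the
  same Schur complement as in \<open>det_schur_complement\<close>, so integrating out a variable and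
  eliminating an index go hand in hand.\<close>

lemma quadratic_form_schur_complement:
  fixes A :: "'a \<Rightarrow> 'a \<Rightarrow> real"
  assumes I: "finite I" "z \<notin> I" and a: "A z z \<noteq> 0"
    and sym: "\<And>i j. A i j = A j i"
  shows "(\<Sum>i\<in>insert z I. \<Sum>j\<in>insert z I. A i j * x i * x j)
    = A z z * (x z + (\<Sum>i\<in>I. A z i * x i) / A z z)\<^sup>2
      + (\<Sum>i\<in>I. \<Sum>j\<in>I. (A i j - A i z * A z j / A z z) * x i * x j)"
proof -
  define S where "S = (\<Sum>i\<in>I. A z i * x i)"
  have 1: "(\<Sum>i\<in>I. A i z * x i * x z) = S * x z" "(\<Sum>j\<in>I. A z j * x z * x j) = x z * S"
    unfolding S_def sum_distrib_left sum_distrib_right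
    by (auto intro!: sum.cong simp: sym[of z] mult_ac)
  have "S = (\<Sum>i\<in>I. A i z * x i)" unfolding S_def by (auto intro!: sum.cong simp: sym[of z])
  then have "S * S / A z z = (\<Sum>i\<in>I. A i z * x i) * (\<Sum>j\<in>I. A z j * x j) / A z z"
    by (simp add: S_def)
  also have "\<dots> = (\<Sum>i\<in>I. \<Sum>j\<in>I. A i z * A z j / A z z * x i * x j)"
    unfolding sum_product sum_divide_distrib by (auto intro!: sum.cong simp: mult_ac)
  finally have "S * S / A z z = (\<Sum>i\<in>I. \<Sum>j\<in>I. A i z * A z j / A z z * x i * x j)" .
  then have 2: "(\<Sum>i\<in>I. \<Sum>j\<in>I. (A i j - A i z * A z j / A z z) * x i * x j)
      = (\<Sum>i\<in>I. \<Sum>j\<in>I. A i j * x i * x j) - S * S / A z z"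
    by (simp add: left_diff_distrib sum_subtractf)
  have 3: "A z z * (x z + S / A z z)\<^sup>2 = A z z * x z * x z + 2 * (x z * S) + S * S / A z z"
    using a by (simp add: power2_eq_square field_simps)
  have "(\<Sum>i\<in>insert z I. \<Sum>j\<in>insert z I. A i j * x i * x j)
      = A z z * x z * x z + x z * S + (S * x z + (\<Sum>i\<in>I. \<Sum>j\<in>I. A i j * x i * x j))"
    using I by (simp add: sum.distrib 1)
  then show ?thesis
    unfolding 2 S_def[symmetric] 3 by simp
qed

definition positive_form :: "'a set \<Rightarrow> ('a \<Rightarrow> 'a \<Rightarrow> real) \<Rightarrow> bool" where
  "positive_form I A \<longleftrightarrow>
     (\<forall>x. (\<exists>i\<in>I. x i \<noteq> 0) \<longrightarrow> 0 < (\<Sum>i\<in>I. \<Sum>j\<in>I. A i j * x i * x j))"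

text \<open>Induction that integrates out the last variable by Fubini: the completed square gives
  \<open>sqrt (2*pi / A z z)\<close>, and the Schur complement is the form for the remaining
  variables, so \<open>A\<close> stays arbitrary. The list fixes an order of the indices for the
  matrix. Positivity of the determinant passes through the same recursion.\<close>

lemma gaussian_integral_det:
  fixes A :: "'a \<Rightarrow> 'a \<Rightarrow> real"
  assumes "distinct xs" "\<And>i j. A i j = A j i" "positive_form (set xs) A"
  defines "d \<equiv> \<lambda>(A :: 'a \<Rightarrow> 'a \<Rightarrow> real) xs. Determinant.det
      (Matrix.mat (length xs) (length xs) (\<lambda>(i,j). A (xs ! i) (xs ! j)))"
  shows "d A xs > 0 \<and>
    (\<integral>\<^sup>+x. ennreal (exp (- (1/2) * (\<Sum>i\<in>set xs. \<Sum>j\<in>set xs. A i j * x i * x j)))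
        \<partial>PiM (set xs) (\<lambda>_. lborel)) = ennreal (sqrt ((2*pi) ^ length xs / d A xs))"
  using assms(1-3)
proof (induction xs arbitrary: A rule: rev_induct)
  case Nil
  have "d A [] = 1" by (simp add: d_def)
  moreover have "(\<integral>\<^sup>+x. ennreal (exp (- (1/2) * (\<Sum>i\<in>set []. \<Sum>j\<in>set []. A i j * x i * x j)))
        \<partial>PiM (set []) (\<lambda>_. lborel)) = 1"
    by (simp add: PiM_empty nn_integral_count_space_finite)
  ultimately show ?case by simp
next
  case (snoc z xs)
  interpret product_sigma_finite "\<lambda>_::'a. lborel :: real measure" ..
  let ?I = "set xs" and ?n = "length xs"
  define A' where "A' = (\<lambda>i j. A i j - A i z * A z j / A z z)"
  have z: "z \<notin> ?I" and dx: "distinct xs" using snoc.prems by auto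
  note sym = snoc.prems(2)
  have ins: "set (xs @ [z]) = insert z ?I" by auto
  have a: "A z z > 0"
  proof -
    have "0 < (\<Sum>i\<in>insert z ?I. \<Sum>j\<in>insert z ?I. A i j * (if i = z then 1 else 0) * (if j = z then 1 else 0))"
      using snoc.prems(3)[unfolded positive_form_def ins, rule_format, of "\<lambda>i. if i = z then 1 else 0"]
      by auto
    also have "\<dots> = A z z"
    proof -
      have "(\<Sum>i\<in>?I. \<Sum>j\<in>insert z ?I. A i j * (if i = z then 1 else 0) * (if j = z then 1 else 0)) = 0"
           "(\<Sum>j\<in>?I. A z j * (if z = z then 1 else 0) * (if j = z then 1 else 0)) = 0"
        using z by (auto intro!: sum.neutral)
      then show ?thesis using z by simp
    qed
    finally show ?thesis .
  qed
  have schur: "(\<Sum>i\<in>insert z ?I. \<Sum>j\<in>insert z ?I. A i j * x i * x j)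
    = A z z * (x z + (\<Sum>i\<in>?I. A z i * x i) / A z z)\<^sup>2
      + (\<Sum>i\<in>?I. \<Sum>j\<in>?I. A' i j * x i * x j)" for x
    unfolding A'_def
    by (rule quadratic_form_schur_complement) (use z a sym in auto)
  have sym': "A' i j = A' j i" for i j
    unfolding A'_def using sym[of i j] sym[of i z] sym[of z j] by simp
  have pos': "positive_form ?I A'"
    unfolding positive_form_def
  proof (intro allI impI)
    fix x :: "'a \<Rightarrow> real" assume x: "\<exists>i\<in>?I. x i \<noteq> 0"
    \<comment> \<open>This value of the coordinate \<open>z\<close> makes the completed square
      vanish, so the form of \<open>A\<close> at \<open>y\<close> equals the form of the Schur
      complement at \<open>x\<close>.\<close>
    define y where "y = x(z := - ((\<Sum>i\<in>?I. A z i * x i) / A z z))"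
    have yx: "y i = x i" if "i \<in> ?I" for i using that z by (auto simp: y_def)
    have "0 < (\<Sum>i\<in>insert z ?I. \<Sum>j\<in>insert z ?I. A i j * y i * y j)"
      using snoc.prems(3) x yx unfolding positive_form_def ins by auto
    also have "\<dots> = (\<Sum>i\<in>?I. \<Sum>j\<in>?I. A' i j * x i * x j)"
      unfolding schur by (simp add: yx y_def[THEN fun_cong, of z] cong: sum.cong)
    finally show "0 < (\<Sum>i\<in>?I. \<Sum>j\<in>?I. A' i j * x i * x j)" .
  qed
  have dd: "d A (xs @ [z]) = A z z * d A' xs"
  proof -
    define B where "B = (\<lambda>i j. A ((xs @ [z]) ! i) ((xs @ [z]) ! j))"
    have "d A (xs @ [z]) = B ?n ?n * Determinant.det
        (Matrix.mat ?n ?n (\<lambda>(i,j). B i j - B i ?n * B ?n j / B ?n ?n))"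
      using det_schur_complement[of B ?n] a by (simp add: d_def B_def)
    also have "Matrix.mat ?n ?n (\<lambda>(i,j). B i j - B i ?n * B ?n j / B ?n ?n)
        = Matrix.mat ?n ?n (\<lambda>(i,j). A' (xs ! i) (xs ! j))"
      by (rule cong_mat) (auto simp: B_def A'_def nth_append)
    finally show ?thesis by (simp add: B_def d_def)
  qed
  from snoc.IH[OF dx sym' pos'] have dpos: "d A' xs > 0" and
    IH: "(\<integral>\<^sup>+x. ennreal (exp (- (1/2) * (\<Sum>i\<in>?I. \<Sum>j\<in>?I. A' i j * x i * x j)))
        \<partial>PiM ?I (\<lambda>_. lborel)) = ennreal (sqrt ((2*pi) ^ ?n / d A' xs))" by auto
  have "(\<integral>\<^sup>+x. ennreal (exp (- (1/2) * (\<Sum>i\<in>insert z ?I. \<Sum>j\<in>insert z ?I. A i j * x i * x j)))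
        \<partial>PiM (insert z ?I) (\<lambda>_. lborel))
      = (\<integral>\<^sup>+x. (\<integral>\<^sup>+y. ennreal (exp (- (1/2) * (\<Sum>i\<in>insert z ?I. \<Sum>j\<in>insert z ?I.
            A i j * (x(z := y)) i * (x(z := y)) j))) \<partial>lborel) \<partial>PiM ?I (\<lambda>_. lborel))"
    by (subst product_nn_integral_insert) (use z in auto)
  also have "\<dots> = (\<integral>\<^sup>+x. ennreal (sqrt (2*pi / A z z)) *
        ennreal (exp (- (1/2) * (\<Sum>i\<in>?I. \<Sum>j\<in>?I. A' i j * x i * x j))) \<partial>PiM ?I (\<lambda>_. lborel))"
  proof (rule nn_integral_cong)
    fix x :: "'a \<Rightarrow> real"
    define c where "c = (\<Sum>i\<in>?I. A z i * x i) / A z z"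
    define e where "e = exp (- (1/2) * (\<Sum>i\<in>?I. \<Sum>j\<in>?I. A' i j * x i * x j))"
    have xx: "(x(z := y)) i = x i" if "i \<in> ?I" for i y using z that by auto
    have "exp (- (1/2) * (\<Sum>i\<in>insert z ?I. \<Sum>j\<in>insert z ?I.
            A i j * (x(z := y)) i * (x(z := y)) j)) = e * exp (- (1/2) * (A z z * (y + c)\<^sup>2))" for y
      unfolding schur
      by (simp only: xx c_def e_def exp_add[symmetric] distrib_left fun_upd_same add.commute
          cong: sum.cong)
    then have "(\<integral>\<^sup>+y. ennreal (exp (- (1/2) * (\<Sum>i\<in>insert z ?I. \<Sum>j\<in>insert z ?I.
            A i j * (x(z := y)) i * (x(z := y)) j))) \<partial>lborel)
        = (\<integral>\<^sup>+y. ennreal e * ennreal (exp (- (1/2) * (A z z * (y + c)\<^sup>2))) \<partial>lborel)"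
      by (simp add: ennreal_mult' e_def)
    also have "\<dots> = ennreal e * ennreal (sqrt (2*pi / A z z))"
      by (subst nn_integral_cmult) (use nn_integral_gaussian[OF a, of c] in auto)
    finally show "(\<integral>\<^sup>+y. ennreal (exp (- (1/2) * (\<Sum>i\<in>insert z ?I. \<Sum>j\<in>insert z ?I.
            A i j * (x(z := y)) i * (x(z := y)) j))) \<partial>lborel)
        = ennreal (sqrt (2*pi / A z z)) * ennreal e" by (simp add: mult.commute)
  qed
  also have "\<dots> = ennreal (sqrt (2*pi / A z z)) * ennreal (sqrt ((2*pi) ^ ?n / d A' xs))"
    unfolding IH[symmetric] by (rule nn_integral_cmult) simp
  also have "\<dots> = ennreal (sqrt ((2*pi) ^ length (xs @ [z]) / d A (xs @ [z])))"
    using a dpos by (simp add: ennreal_mult'[symmetric] real_sqrt_mult[symmetric] dd)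
  finally show ?case using a dpos by (simp add: ins dd)
qed

text \<open>With the \<open>v k\<close> as columns of \<open>H\<close>, the eigenvalue equations
  read \<open>M * H = H * E\<close>. Orthonormality makes the determinant of \<open>H\<close>
  nonzero, so it cancels, and the determinant of \<open>M\<close> is the product of the
  eigenvalues.\<close>

lemma gaussian_integral_eigenbasis:
  fixes A v :: "'a \<Rightarrow> 'a \<Rightarrow> real"
  assumes I: "finite I" and sym: "\<And>i j. A i j = A j i" and pos: "positive_form I A"
    and orth: "\<And>k l. k \<in> I \<Longrightarrow> l \<in> I \<Longrightarrow> (\<Sum>i\<in>I. v k i * v l i) = (if k = l then 1 else 0)"
    and eig: "\<And>k i. k \<in> I \<Longrightarrow> i \<in> I \<Longrightarrow> (\<Sum>j\<in>I. A i j * v k j) = ev k * v k i"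
  shows "(\<integral>\<^sup>+x. ennreal (exp (- (1/2) * (\<Sum>i\<in>I. \<Sum>j\<in>I. A i j * x i * x j)))
        \<partial>PiM I (\<lambda>_. lborel)) = ennreal (sqrt ((2*pi) ^ card I / (\<Prod>k\<in>I. ev k)))"
proof -
  obtain xs where xs: "set xs = I" "distinct xs" using finite_distinct_list[OF I] by auto
  define n where "n = length xs"
  have n: "n = card I" using xs distinct_card n_def by metis
  have mem: "xs ! i \<in> I" if "i < n" for i using that xs n_def by auto
  have bij: "bij_betw ((!) xs) {..<n} I"
    using bij_betw_nth[OF xs(2)] xs(1) n_def by auto
  have reindex: "(\<Sum>i<n. f (xs ! i)) = (\<Sum>i\<in>I. f i)" for f :: "'a \<Rightarrow> real"
    by (rule sum.reindex_bij_betw[OF bij])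
  define M where "M = Matrix.mat n n (\<lambda>(i,j). A (xs ! i) (xs ! j))"
  define H where "H = Matrix.mat n n (\<lambda>(i,k). v (xs ! k) (xs ! i))"
  define E where "E = Matrix.mat n n (\<lambda>(i,k). if i = k then ev (xs ! k) else 0)"
  have car: "M \<in> carrier_mat n n" "H \<in> carrier_mat n n" "E \<in> carrier_mat n n"
      "transpose_mat H \<in> carrier_mat n n"
    by (auto simp: M_def H_def E_def)
  have ME: "M * H = H * E"
  proof (rule eq_matI)
    fix i k assume "i < dim_row (H * E)" "k < dim_col (H * E)"
    then have ik: "i < n" "k < n" using car by auto
    have "(M * H) $$ (i,k) = (\<Sum>j<n. A (xs ! i) (xs ! j) * v (xs ! k) (xs ! j))"
      using ik by (auto simp: M_def H_def times_mat_def scalar_prod_def lessThan_atLeast0)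
    also have "\<dots> = ev (xs ! k) * v (xs ! k) (xs ! i)"
      using reindex[of "\<lambda>j. A (xs ! i) j * v (xs ! k) j"] ik by (simp add: eig mem)
    also have "\<dots> = (\<Sum>j<n. v (xs ! j) (xs ! i) * (if j = k then ev (xs ! k) else 0))"
      using ik by (simp add: if_distrib sum.delta cong: if_cong)
    also have "\<dots> = (H * E) $$ (i,k)"
      using ik by (auto simp: H_def E_def times_mat_def scalar_prod_def lessThan_atLeast0
          intro!: sum.cong)
    finally show "(M * H) $$ (i,k) = (H * E) $$ (i,k)" .
  qed (use car in auto)
  have HH: "transpose_mat H * H = 1\<^sub>m n"
  proof (rule eq_matI)
    fix k l assume "k < dim_row (1\<^sub>m n)" "l < dim_col (1\<^sub>m n)"
    then have kl: "k < n" "l < n" by auto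
    have "(transpose_mat H * H) $$ (k,l) = (\<Sum>j<n. v (xs ! k) (xs ! j) * v (xs ! l) (xs ! j))"
      using kl by (auto simp: H_def times_mat_def scalar_prod_def lessThan_atLeast0)
    also have "\<dots> = (if k = l then 1 else 0)"
      using reindex[of "\<lambda>j. v (xs ! k) j * v (xs ! l) j"] kl xs(2)
      by (simp add: orth mem nth_eq_iff_index_eq n_def)
    finally show "(transpose_mat H * H) $$ (k,l) = 1\<^sub>m n $$ (k,l)" using kl by simp
  qed (use car in auto)
  have "Determinant.det (transpose_mat H) * Determinant.det H = 1"
    using HH det_mult[OF car(4) car(2)] by simp
  then have "Determinant.det H \<noteq> 0" by auto
  moreover have "Determinant.det M * Determinant.det H = Determinant.det H * Determinant.det E"
    by (metis ME det_mult car(1-3))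
  ultimately have "Determinant.det M = Determinant.det E" by simp
  also have "\<dots> = prod_list (diag_mat E)"
    by (rule det_lower_triangular[OF _ car(3)]) (auto simp: E_def)
  also have "\<dots> = (\<Prod>k<n. ev (xs ! k))"
    by (auto simp: prod_list_diag_prod E_def lessThan_atLeast0 intro!: prod.cong)
  also have "\<dots> = (\<Prod>k\<in>I. ev k)"
    by (rule prod.reindex_bij_betw[OF bij])
  finally have det: "Determinant.det (Matrix.mat (length xs) (length xs)
      (\<lambda>(i,j). A (xs ! i) (xs ! j))) = (\<Prod>k\<in>I. ev k)" by (simp add: M_def n_def)
  from gaussian_integral_det[OF xs(2), of A, OF sym, unfolded xs(1) det, OF pos]
  show ?thesis using n n_def by simp
qed

subsection \<open>Spin waves on the torus\<close>

lemma finite_torus [simp]: "finite (torus L)"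
  by (simp add: torus_def)

lemma card_torus: "card (torus L) = L ^ 3"
  by (simp add: torus_def power3_eq_cube)

lemma bij_betw_Suc_mod: "bij_betw (\<lambda>i. Suc i mod L) {0..<L} {0..<L}"
proof (cases "L = 0")
  case False
  have "inj_on (\<lambda>i. Suc i mod L) {0..<L}"
    by (auto simp: inj_on_def mod_Suc split: if_splits)
  moreover have "(\<lambda>i. Suc i mod L) ` {0..<L} \<subseteq> {0..<L}" using False by auto
  ultimately show ?thesis
    by (simp add: bij_betw_def endo_inj_surj)
qed (simp add: bij_betw_def)

lemma bij_betw_shift:
  "bij_betw (shift1 L) (torus L) (torus L)"
  "bij_betw (shift2 L) (torus L) (torus L)"
  "bij_betw (shift3 L) (torus L) (torus L)"
proof -
  let ?s = "\<lambda>i. Suc i mod L"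
  have id: "bij_betw (\<lambda>x. x) S S" for S :: "'b set" by (simp add: bij_betw_def)
  have "shift1 L = map_prod ?s (map_prod (\<lambda>x. x) (\<lambda>x. x))"
       "shift2 L = map_prod (\<lambda>x. x) (map_prod ?s (\<lambda>x. x))"
       "shift3 L = map_prod (\<lambda>x. x) (map_prod (\<lambda>x. x) ?s)"
    by (auto simp: shift1_def shift2_def shift3_def fun_eq_iff)
  then show "bij_betw (shift1 L) (torus L) (torus L)"
    "bij_betw (shift2 L) (torus L) (torus L)" "bij_betw (shift3 L) (torus L) (torus L)"
    unfolding torus_def by (simp_all add: bij_betw_map_prod id bij_betw_Suc_mod)
qed

text \<open>The labels are centred so that the momenta lie in \<open>[-\<pi>, \<pi>)\<close>, matching the domain of integration
  of the spin-wave free energy.\<close>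
definition momentum :: "nat \<Rightarrow> nat \<Rightarrow> real" where
  "momentum L j = 2 * pi * of_int (int j - int (L div 2)) / real L"

definition phase :: "nat \<Rightarrow> nat \<times> nat \<times> nat \<Rightarrow> nat \<times> nat \<times> nat \<Rightarrow> real" where
  "phase L j x = momentum L (fst j) * real (fst x) + momentum L (fst (snd j)) * real (fst (snd x))
     + momentum L (snd (snd j)) * real (snd (snd x))"

text \<open>The real counterpart of the characters. One function \<open>cos + sin\<close> for each
  momentum already gives a full real basis, with no pairing of \<open>k\<close> with
  \<open>-k\<close> and no exceptions at self-conjugate momenta.\<close>

definition hartley :: "nat \<Rightarrow> nat \<times> nat \<times> nat \<Rightarrow> nat \<times> nat \<times> nat \<Rightarrow> real" where
  "hartley L j x = (cos (phase L j x) + sin (phase L j x)) / sqrt (real (L ^ 3))"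

text \<open>A geometric series with ratio \<open>w\<close>: always \<open>w ^ L = 1\<close>, and
  \<open>w = 1\<close> exactly when \<open>L\<close> divides \<open>m\<close>.\<close>

lemma sum_cis_period:
  fixes m :: int
  assumes "L > 0"
  shows "(\<Sum>x\<in>{0..<L}. cis (2 * pi * of_int m / real L * real x)) = (if int L dvd m then of_nat L else 0)"
proof -
  define w where "w = cis (2 * pi * of_int m / real L)"
  have pw: "cis (2 * pi * of_int m / real L * real x) = w ^ x" for x
    by (simp only: w_def Complex.DeMoivre mult.commute[of _ "real x"])
  have wL: "w ^ L = 1"
    using assms cis_multiple_2pi[of "of_int m"] by (simp add: w_def Complex.DeMoivre)
  show ?thesis
  proof (cases "int L dvd m")
    case True
    then obtain c where "m = int L * c" by auto
    then have "w = 1" using assms cis_multiple_2pi[of "of_int c"] by (simp add: w_def mult.assoc)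
    then show ?thesis using True by (simp only: pw) simp
  next
    case False
    have "w \<noteq> 1"
    proof
      assume "w = 1"
      then have "cos (2 * pi * of_int m / real L) = 1" by (simp add: w_def complex_eq_iff)
      then obtain c where "2 * pi * of_int m / real L = of_int c * 2 * pi"
        using cos_one_2pi_int by auto
      then have "real_of_int m = of_int (c * int L)" using assms by (simp add: field_simps)
      then have "m = c * int L" by (simp only: of_int_eq_iff)
      then show False using False by simp
    qed
    then have "(\<Sum>x\<in>{0..<L}. w ^ x) = 0" using wL
      by (simp add: sum_gp_strict atLeast0LessThan)
    then show ?thesis using False by (simp only: pw) simp
  qed
qed

lemma sum_cis_torus:
  fixes m :: "int \<times> int \<times> int"
  assumes "L > 0"
  shows "(\<Sum>x\<in>torus L. cis (2 * pi * of_int (fst m) / real L * real (fst x)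
      + 2 * pi * of_int (fst (snd m)) / real L * real (fst (snd x))
      + 2 * pi * of_int (snd (snd m)) / real L * real (snd (snd x))))
    = (if int L dvd fst m \<and> int L dvd fst (snd m) \<and> int L dvd snd (snd m) then of_nat (L ^ 3) else 0)"
proof -
  define c where "c = (\<lambda>m x. cis (2 * pi * of_int m / real L * real x))"
  have "(\<Sum>x\<in>torus L. cis (2 * pi * of_int (fst m) / real L * real (fst x)
      + 2 * pi * of_int (fst (snd m)) / real L * real (fst (snd x))
      + 2 * pi * of_int (snd (snd m)) / real L * real (snd (snd x))))
    = (\<Sum>x\<in>torus L. c (fst m) (fst x) * (c (fst (snd m)) (fst (snd x)) * c (snd (snd m)) (snd (snd x))))"
    by (simp add: c_def cis_mult add_ac)
  also have "\<dots> = (\<Sum>x\<in>{0..<L}. c (fst m) x) * ((\<Sum>x\<in>{0..<L}. c (fst (snd m)) x) * (\<Sum>x\<in>{0..<L}. c (snd (snd m)) x))"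
    by (simp add: torus_def sum.cartesian_product' flip: sum_distrib_left sum_distrib_right)
  finally show ?thesis
    unfolding c_def sum_cis_period[OF assms] by (simp add: power3_eq_cube)
qed

text \<open>The values of \<open>cos + sin\<close> at \<open>a\<close> and \<open>b\<close> multiply
  to \<open>cos (a - b) + sin (a + b)\<close>. Both terms are parts of character sums, which are
  real, being \<open>0\<close> or \<open>L ^ 3\<close>. Hence the sine part drops out and the cosine
  part survives only for equal labels.\<close>

lemma hartley_orthonormal:
  assumes "L > 0" "j \<in> torus L" "k \<in> torus L"
  shows "(\<Sum>x\<in>torus L. hartley L j x * hartley L k x) = (if j = k then 1 else 0)"
proof -
  define h where "h = int (L div 2)"
  obtain j1 j2 j3 k1 k2 k3 where jk: "j = (j1,j2,j3)" "k = (k1,k2,k3)"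
    by (metis prod_cases3)
  define d where "d = (int j1 - int k1, int j2 - int k2, int j3 - int k3)"
  \<comment> \<open>The centring offset \<open>h\<close> is subtracted once from each label, so it
    cancels in the difference \<open>d\<close> and appears twice in the sum
    \<open>s\<close>.\<close>
  define s where "s = (int j1 + int k1 - 2*h, int j2 + int k2 - 2*h, int j3 + int k3 - 2*h)"
  define f where "f = (\<lambda>(m :: int \<times> int \<times> int) x. 2 * pi * of_int (fst m) / real L * real (fst x)
      + 2 * pi * of_int (fst (snd m)) / real L * real (fst (snd x))
      + 2 * pi * of_int (snd (snd m)) / real L * real (snd (snd x)))"
  have pd: "phase L j x - phase L k x = f d x" for x :: "nat \<times> nat \<times> nat"
    using assms(1) by (simp add: phase_def momentum_def f_def d_def jk field_simps)
  have ps: "phase L j x + phase L k x = f s x" for x :: "nat \<times> nat \<times> nat"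
    using assms(1) by (simp add: phase_def momentum_def f_def s_def h_def jk field_simps)
  have "hartley L j x * hartley L k x = (Re (cis (f d x)) + Im (cis (f s x))) / real (L ^ 3)" for x
    unfolding pd[symmetric] ps[symmetric] using assms(1)
    by (simp add: hartley_def cos_diff sin_add algebra_simps add_divide_distrib
        real_sqrt_mult[symmetric] flip: times_divide_eq_right)
  then have "(\<Sum>x\<in>torus L. hartley L j x * hartley L k x)
      = (Re (\<Sum>x\<in>torus L. cis (f d x)) + Im (\<Sum>x\<in>torus L. cis (f s x))) / real (L ^ 3)"
    by (simp add: sum.distrib sum_divide_distrib add_divide_distrib)
  also have "Im (\<Sum>x\<in>torus L. cis (f s x)) = 0"
    unfolding f_def sum_cis_torus[OF assms(1)] by simp
  also have "(\<Sum>x\<in>torus L. cis (f d x)) = (if j = k then of_nat (L ^ 3) else 0)"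
  proof -
    have dv: "int L dvd int a - int b \<longleftrightarrow> a = b" if "a < L" "b < L" for a b
      using zdvd_not_zless[of "int a - int b" "int L"] zdvd_not_zless[of "int b - int a" "int L"] that
      by (cases a b rule: linorder_cases) (auto simp: dvd_diff_commute)
    show ?thesis
      unfolding f_def sum_cis_torus[OF assms(1)] using assms(2,3)
      by (simp add: d_def jk torus_def dv)
  qed
  finally show ?thesis using assms(1) by simp
qed

section \<open>The lattice gradient form and its spectrum\<close>

definition dispersion :: "real \<times> real \<times> real \<Rightarrow> real \<times> real \<times> real \<Rightarrow> real" where
  "dispersion q k = fst q * (2 - 2 * cos (fst k)) + fst (snd q) * (2 - 2 * cos (fst (snd k)))
     + snd (snd q) * (2 - 2 * cos (snd (snd k)))"

definition torus_momentum :: "nat \<Rightarrow> nat \<times> nat \<times> nat \<Rightarrow> real \<times> real \<times> real" where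
  "torus_momentum L j = (momentum L (fst j), momentum L (fst (snd j)), momentum L (snd (snd j)))"

definition dirichlet :: "real \<times> real \<times> real \<Rightarrow> nat \<Rightarrow> (nat \<times> nat \<times> nat \<Rightarrow> real) \<Rightarrow> real" where
  "dirichlet q L x = (\<Sum>r\<in>torus L. fst q * (x r - x (shift1 L r))\<^sup>2
     + fst (snd q) * (x r - x (shift2 L r))\<^sup>2 + snd (snd q) * (x r - x (shift3 L r))\<^sup>2)"

text \<open>The matrix of the squared differences between \<open>r\<close> and \<open>s r\<close>.
  The Boolean terms are added rather than split into cases, so that coinciding neighbours, as for
  \<open>L = 1\<close> and \<open>L = 2\<close>, are counted correctly.\<close>

definition bond_matrix :: "('a \<Rightarrow> 'a) \<Rightarrow> 'a \<Rightarrow> 'a \<Rightarrow> real" where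
  "bond_matrix s r t = 2 * of_bool (r = t) - of_bool (t = s r) - of_bool (r = s t)"

lemma bond_matrix_sym: "bond_matrix s r t = bond_matrix s t r"
  by (auto simp: bond_matrix_def)

lemma bond_matrix_form:
  assumes T: "finite T" and s: "bij_betw s T T"
  shows "(\<Sum>r\<in>T. \<Sum>t\<in>T. bond_matrix s r t * x r * x t) = (\<Sum>r\<in>T. (x r - x (s r))\<^sup>2)"
proof -
  have sT: "s r \<in> T" if "r \<in> T" for r using s that by (auto simp: bij_betw_def)
  have 1: "(\<Sum>r\<in>T. \<Sum>t\<in>T. of_bool (r = t) * x r * x t) = (\<Sum>r\<in>T. (x r)\<^sup>2)"
    using T by (intro sum.cong) (auto simp: of_bool_def if_distrib if_distribR power2_eq_square sum.delta cong: if_cong)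
  have 2: "(\<Sum>r\<in>T. \<Sum>t\<in>T. of_bool (t = s r) * x r * x t) = (\<Sum>r\<in>T. x r * x (s r))"
    using T sT by (intro sum.cong) (auto simp: of_bool_def if_distrib if_distribR sum.delta cong: if_cong)
  have 3: "(\<Sum>r\<in>T. \<Sum>t\<in>T. of_bool (r = s t) * x r * x t) = (\<Sum>r\<in>T. x r * x (s r))"
    by (subst sum.swap) (simp add: 2[symmetric] mult_ac)
  have 4: "(\<Sum>r\<in>T. (x (s r))\<^sup>2) = (\<Sum>r\<in>T. (x r)\<^sup>2)"
    by (rule sum.reindex_bij_betw[OF s])
  have "(\<Sum>r\<in>T. \<Sum>t\<in>T. bond_matrix s r t * x r * x t)
     = 2 * (\<Sum>r\<in>T. \<Sum>t\<in>T. of_bool (r = t) * x r * x t)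
       - (\<Sum>r\<in>T. \<Sum>t\<in>T. of_bool (t = s r) * x r * x t)
       - (\<Sum>r\<in>T. \<Sum>t\<in>T. of_bool (r = s t) * x r * x t)"
    by (simp only: bond_matrix_def left_diff_distrib sum_subtractf sum_distrib_left mult.assoc)
  also have "\<dots> = (\<Sum>r\<in>T. (x r)\<^sup>2) + (\<Sum>r\<in>T. (x (s r))\<^sup>2) - 2 * (\<Sum>r\<in>T. x r * x (s r))"
    unfolding 1 2 3 4 by simp
  also have "\<dots> = (\<Sum>r\<in>T. (x r - x (s r))\<^sup>2)"
    by (simp add: power2_diff sum.distrib sum_subtractf sum_distrib_left mult_ac)
  finally show ?thesis .
qed

text \<open>Along \<open>s\<close> the phase grows by \<open>k\<close> modulo \<open>2 * pi\<close>.
  The values of \<open>cos + sin\<close> at \<open>y + k\<close> and \<open>y - k\<close> add up to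
  \<open>2 * cos k\<close> times the value at \<open>y\<close>, so the forward and the backward
  neighbour \<open>u\<close> together reproduce the value at \<open>r\<close>.\<close>

lemma bond_matrix_cas:
  assumes T: "finite T" and s: "bij_betw s T T" and r: "r \<in> T"
    and p: "\<And>t. t \<in> T \<Longrightarrow> \<exists>n::int. p (s t) = p t + k + 2 * pi * of_int n"
  shows "(\<Sum>t\<in>T. bond_matrix s r t * (cos (p t) + sin (p t)))
       = (2 - 2 * cos k) * (cos (p r) + sin (p r))"
proof -
  obtain u where u: "u \<in> T" "r = s u" using s r by (auto simp: bij_betw_def)
  have ru: "r = s t \<longleftrightarrow> t = u" if "t \<in> T" for t
    using s u that by (auto simp: bij_betw_def inj_on_def)
  have sr: "s r \<in> T" using s r by (auto simp: bij_betw_def)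
  have per: "cos (y + 2 * pi * of_int n) = cos y" "sin (y + 2 * pi * of_int n) = sin y" for y and n :: int
    by (simp_all add: cos_add sin_add cos_int_2pin sin_int_2pin)
  obtain n where n: "p (s r) = p r + k + 2 * pi * of_int n" using p r by blast
  have fw: "cos (p (s r)) = cos (p r + k)" "sin (p (s r)) = sin (p r + k)"
    unfolding n per by simp_all
  obtain n' where n': "p r = p u + k + 2 * pi * of_int n'" using p u by blast
  then have n'': "p u = (p r - k) + 2 * pi * of_int (- n')" by simp
  have bw: "cos (p u) = cos (p r - k)" "sin (p u) = sin (p r - k)"
    unfolding n'' per by simp_all
  have "(\<Sum>t\<in>T. bond_matrix s r t * (cos (p t) + sin (p t)))
      = (\<Sum>t\<in>T. (if r = t then 2 * (cos (p t) + sin (p t)) else 0)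
         - (if t = s r then cos (p t) + sin (p t) else 0) - (if t = u then cos (p t) + sin (p t) else 0))"
    by (intro sum.cong) (auto simp: bond_matrix_def ru algebra_simps)
  also have "\<dots> = 2 * (cos (p r) + sin (p r)) - (cos (p (s r)) + sin (p (s r))) - (cos (p u) + sin (p u))"
    using T r sr u by (simp add: sum_subtractf)
  also have "\<dots> = (2 - 2 * cos k) * (cos (p r) + sin (p r))"
    unfolding fw bw by (simp add: cos_add sin_add cos_diff sin_diff algebra_simps)
  finally show ?thesis .
qed

text \<open>Only the seam \<open>i = L - 1\<close> matters: there
  \<open>momentum L a * real L\<close> is an integer multiple of \<open>2 * pi\<close>, so phases
  are well defined on the torus modulo \<open>2 * pi\<close>.\<close>

lemma momentum_wrap:
  assumes "L > 0" "i < L"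
  shows "\<exists>n::int. momentum L a * real ((i + 1) mod L) = momentum L a * real i + momentum L a + 2 * pi * of_int n"
proof (cases "Suc i = L")
  case True
  have "momentum L a * real L = 2 * pi * of_int (int a - int (L div 2))"
    using assms by (simp add: momentum_def)
  moreover have "real L = real i + 1" using True by simp
  ultimately have "momentum L a * real i + momentum L a = 2 * pi * of_int (int a - int (L div 2))"
    by (simp add: algebra_simps)
  then show ?thesis using True
    by (intro exI[of _ "- (int a - int (L div 2))"]) (simp add: algebra_simps)
next
  case False
  then show ?thesis using assms
    by (intro exI[of _ 0]) (simp add: algebra_simps)
qed

lemma phase_shift:
  assumes "L > 0" "x \<in> torus L"
  shows "\<exists>n::int. phase L j (shift1 L x) = phase L j x + momentum L (fst j) + 2 * pi * of_int n"
    "\<exists>n::int. phase L j (shift2 L x) = phase L j x + momentum L (fst (snd j)) + 2 * pi * of_int n"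
    "\<exists>n::int. phase L j (shift3 L x) = phase L j x + momentum L (snd (snd j)) + 2 * pi * of_int n"
  using assms momentum_wrap[of L "fst x" "fst j"] momentum_wrap[of L "fst (snd x)" "fst (snd j)"]
    momentum_wrap[of L "snd (snd x)" "snd (snd j)"]
  by (auto simp: phase_def shift1_def shift2_def shift3_def torus_def split: prod.splits)

definition massive_matrix :: "real \<times> real \<times> real \<Rightarrow> real \<Rightarrow> nat
    \<Rightarrow> nat \<times> nat \<times> nat \<Rightarrow> nat \<times> nat \<times> nat \<Rightarrow> real" where
  "massive_matrix q m L r t = m * of_bool (r = t) + fst q * bond_matrix (shift1 L) r t
     + fst (snd q) * bond_matrix (shift2 L) r t + snd (snd q) * bond_matrix (shift3 L) r t"

lemma massive_matrix_form:
  "(\<Sum>r\<in>torus L. \<Sum>t\<in>torus L. massive_matrix q m L r t * x r * x t)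
     = dirichlet q L x + m * (\<Sum>r\<in>torus L. (x r)\<^sup>2)"
proof -
  have 1: "(\<Sum>r\<in>torus L. \<Sum>t\<in>torus L. of_bool (r = t) * x r * x t) = (\<Sum>r\<in>torus L. (x r)\<^sup>2)"
    by (intro sum.cong) (auto simp: of_bool_def if_distrib if_distribR power2_eq_square sum.delta cong: if_cong)
  have "(\<Sum>r\<in>torus L. \<Sum>t\<in>torus L. massive_matrix q m L r t * x r * x t)
    = m * (\<Sum>r\<in>torus L. \<Sum>t\<in>torus L. of_bool (r = t) * x r * x t)
      + fst q * (\<Sum>r\<in>torus L. \<Sum>t\<in>torus L. bond_matrix (shift1 L) r t * x r * x t)
      + fst (snd q) * (\<Sum>r\<in>torus L. \<Sum>t\<in>torus L. bond_matrix (shift2 L) r t * x r * x t)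
      + snd (snd q) * (\<Sum>r\<in>torus L. \<Sum>t\<in>torus L. bond_matrix (shift3 L) r t * x r * x t)"
    by (simp only: massive_matrix_def distrib_right sum.distrib sum_distrib_left mult.assoc)
  then show ?thesis
    by (simp add: 1 bond_matrix_form bij_betw_shift dirichlet_def sum.distrib sum_distrib_left)
qed

lemma massive_matrix_hartley:
  assumes "L > 0" "r \<in> torus L"
  shows "(\<Sum>t\<in>torus L. massive_matrix q m L r t * hartley L j t)
     = (dispersion q (torus_momentum L j) + m) * hartley L j r"
proof -
  define c where "c = (\<lambda>t. cos (phase L j t) + sin (phase L j t))"
  have 1: "(\<Sum>t\<in>torus L. of_bool (r = t) * c t) = c r"
    using assms by (simp add: of_bool_def if_distrib if_distribR sum.delta cong: if_cong)
  have 2: "(\<Sum>t\<in>torus L. bond_matrix (shift1 L) r t * c t) = (2 - 2 * cos (momentum L (fst j))) * c r"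
    "(\<Sum>t\<in>torus L. bond_matrix (shift2 L) r t * c t) = (2 - 2 * cos (momentum L (fst (snd j)))) * c r"
    "(\<Sum>t\<in>torus L. bond_matrix (shift3 L) r t * c t) = (2 - 2 * cos (momentum L (snd (snd j)))) * c r"
    unfolding c_def
    by (intro bond_matrix_cas finite_torus bij_betw_shift phase_shift assms; assumption)+
  have "(\<Sum>t\<in>torus L. massive_matrix q m L r t * c t)
    = m * (\<Sum>t\<in>torus L. of_bool (r = t) * c t)
      + fst q * (\<Sum>t\<in>torus L. bond_matrix (shift1 L) r t * c t)
      + fst (snd q) * (\<Sum>t\<in>torus L. bond_matrix (shift2 L) r t * c t)
      + snd (snd q) * (\<Sum>t\<in>torus L. bond_matrix (shift3 L) r t * c t)"
    by (simp only: massive_matrix_def distrib_right sum.distrib sum_distrib_left mult.assoc)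
  also have "\<dots> = (dispersion q (torus_momentum L j) + m) * c r"
    unfolding 1 2 by (simp add: dispersion_def torus_momentum_def algebra_simps)
  finally show ?thesis
    by (simp add: hartley_def c_def sum_divide_distrib[symmetric])
qed

lemma dirichlet_nonneg:
  assumes "fst q \<ge> 0" "fst (snd q) \<ge> 0" "snd (snd q) \<ge> 0"
  shows "dirichlet q L x \<ge> 0"
  unfolding dirichlet_def using assms by (intro sum_nonneg) auto

lemma dispersion_nonneg:
  assumes "fst q \<ge> 0" "fst (snd q) \<ge> 0" "snd (snd q) \<ge> 0"
  shows "dispersion q k \<ge> 0"
  unfolding dispersion_def using assms by auto

text \<open>The mass makes the form positive definite; the gradient energy alone vanishes on
  constant fields. The Hartley functions diagonalise the form with eigenvalues
  \<open>b * (D + m)\<close>. The result is written as an exponential in preparation for a logarithm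
  per site.\<close>

lemma massive_gaussian_integral:
  assumes L: "L > 0" and b: "b > 0" and m: "m > 0"
    and q: "fst q \<ge> 0" "fst (snd q) \<ge> 0" "snd (snd q) \<ge> 0"
  shows "(\<integral>\<^sup>+x. ennreal (exp (- (b/2) * (dirichlet q L x + m * (\<Sum>r\<in>torus L. (x r)\<^sup>2))))
        \<partial>PiM (torus L) (\<lambda>_. lborel))
     = ennreal (exp (- (real L ^ 3) / 2 * ln (b / (2*pi))
         - (\<Sum>j\<in>torus L. ln (dispersion q (torus_momentum L j) + m)) / 2))"
proof -
  define A where "A = (\<lambda>r t. b * massive_matrix q m L r t)"
  define ev where "ev = (\<lambda>j. b * (dispersion q (torus_momentum L j) + m))"
  have form: "(\<Sum>r\<in>torus L. \<Sum>t\<in>torus L. A r t * x r * x t)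
      = b * (dirichlet q L x + m * (\<Sum>r\<in>torus L. (x r)\<^sup>2))" for x
    unfolding massive_matrix_form[symmetric] by (simp add: A_def sum_distrib_left mult_ac)
  have sym: "A r t = A t r" for r t
    by (simp add: A_def massive_matrix_def bond_matrix_sym[of _ r t] eq_commute[of r t])
  have pos: "positive_form (torus L) A"
    unfolding positive_form_def form
  proof (intro allI impI)
    fix x :: "nat \<times> nat \<times> nat \<Rightarrow> real" assume "\<exists>i\<in>torus L. x i \<noteq> 0"
    then have "0 < (\<Sum>r\<in>torus L. (x r)\<^sup>2)" by (auto intro: sum_pos2)
    then have "0 < m * (\<Sum>r\<in>torus L. (x r)\<^sup>2)" using m by simp
    then show "0 < b * (dirichlet q L x + m * (\<Sum>r\<in>torus L. (x r)\<^sup>2))"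
      using b dirichlet_nonneg[OF q, of L x] by simp
  qed
  have evpos: "dispersion q (torus_momentum L j) + m > 0" for j
    using dispersion_nonneg[OF q, of "torus_momentum L j"] m by simp
  have ev0: "dispersion q (torus_momentum L j) + m \<noteq> 0" for j
    using evpos[of j] by simp
  have eig: "(\<Sum>t\<in>torus L. A r t * hartley L j t) = ev j * hartley L j r" if "r \<in> torus L" for r j
    using massive_matrix_hartley[OF L that, of q m j]
    by (simp add: A_def ev_def mult.assoc sum_distrib_left[symmetric])
  have "(\<integral>\<^sup>+x. ennreal (exp (- (1/2) * (\<Sum>r\<in>torus L. \<Sum>t\<in>torus L. A r t * x r * x t)))
        \<partial>PiM (torus L) (\<lambda>_. lborel)) = ennreal (sqrt ((2*pi) ^ card (torus L) / (\<Prod>j\<in>torus L. ev j)))"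
    by (rule gaussian_integral_eigenbasis[OF finite_torus sym pos hartley_orthonormal[OF L] eig])
  also have "sqrt ((2*pi) ^ card (torus L) / (\<Prod>j\<in>torus L. ev j))
      = exp (- (real L ^ 3) / 2 * ln (b / (2*pi))
         - (\<Sum>j\<in>torus L. ln (dispersion q (torus_momentum L j) + m)) / 2)"
  proof -
    have P: "(\<Prod>j\<in>torus L. ev j) > 0" using evpos b by (simp add: ev_def prod_pos)
    have "ln (\<Prod>j\<in>torus L. ev j) = (\<Sum>j\<in>torus L. ln b + ln (dispersion q (torus_momentum L j) + m))"
      using evpos b by (subst ln_prod) (simp_all add: ev_def ln_mult ev0)
    also have "\<dots> = real L ^ 3 * ln b + (\<Sum>j\<in>torus L. ln (dispersion q (torus_momentum L j) + m))"
      by (simp add: sum.distrib card_torus)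
    finally have lnP: "ln (\<Prod>j\<in>torus L. ev j)
        = real L ^ 3 * ln b + (\<Sum>j\<in>torus L. ln (dispersion q (torus_momentum L j) + m))" .
    have "ln (sqrt ((2*pi) ^ card (torus L) / (\<Prod>j\<in>torus L. ev j)))
       = (real L ^ 3 * ln (2*pi) - ln (\<Prod>j\<in>torus L. ev j)) / 2"
    proof -
      have gen: "ln (sqrt (X / Y)) = (ln X - ln Y) / 2" if "X > 0" "Y > 0" for X Y :: real
        using that by (simp add: ln_sqrt ln_div)
      have "ln ((2*pi) ^ card (torus L)) = real L ^ 3 * ln (2*pi)"
        by (subst ln_realpow) (simp_all add: card_torus)
      then show ?thesis using gen[OF _ P, of "(2*pi) ^ card (torus L)"] by simp
    qed
    also have "\<dots> = - (real L ^ 3) / 2 * ln (b / (2*pi))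
         - (\<Sum>j\<in>torus L. ln (dispersion q (torus_momentum L j) + m)) / 2"
      unfolding lnP using b by (simp add: ln_div field_simps)
    finally show ?thesis using P
      by (metis exp_ln real_sqrt_gt_zero divide_pos_pos zero_less_power pi_gt_zero mult_pos_pos zero_less_numeral)
  qed
  finally show ?thesis unfolding form by (simp add: mult.assoc)
qed

subsection \<open>Substitution in product integrals\<close>

text \<open>Lifts a one-dimensional change of variables to a finite product. The hypothesis
  \<open>eq\<close> says that \<open>g\<close> pushes the measure \<open>w dN\<close> forward to
  \<open>v dM\<close>. Product measures are determined by boxes, so the product of the measures
  \<open>v dM\<close> is both a density over the product of \<open>M\<close> and the push-forward of
  the weighted product of \<open>N\<close>.\<close>

lemma PiM_nn_integral_substitution:
  fixes v :: "'b \<Rightarrow> ennreal" and w :: "'c \<Rightarrow> ennreal"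
  assumes I: "finite I" and M: "sigma_finite_measure M" and N: "sigma_finite_measure N"
    and D: "sigma_finite_measure (density M v)"
    and v[measurable]: "v \<in> borel_measurable M" and w[measurable]: "w \<in> borel_measurable N"
    and g[measurable]: "g \<in> measurable N M"
    and eq: "\<And>A. A \<in> sets M \<Longrightarrow>
      (\<integral>\<^sup>+y. v y * indicator A y \<partial>M) = (\<integral>\<^sup>+x. w x * indicator A (g x) \<partial>N)"
    and F[measurable]: "F \<in> borel_measurable (PiM I (\<lambda>_. M))"
  shows "(\<integral>\<^sup>+y. (\<Prod>i\<in>I. v (y i)) * F y \<partial>PiM I (\<lambda>_. M))
       = (\<integral>\<^sup>+x. (\<Prod>i\<in>I. w (x i)) * F (\<lambda>i\<in>I. g (x i)) \<partial>PiM I (\<lambda>_. N))"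
proof -
  interpret M: product_sigma_finite "\<lambda>_::'a. M" by (rule product_sigma_finite.intro) (rule M)
  interpret N: product_sigma_finite "\<lambda>_::'a. N" by (rule product_sigma_finite.intro) (rule N)
  interpret D: product_sigma_finite "\<lambda>_::'a. density M v" by (rule product_sigma_finite.intro) (rule D)
  define G where "G = (\<lambda>x. \<lambda>i\<in>I. g (x i))"
  have G[measurable]: "G \<in> measurable (PiM I (\<lambda>_. N)) (PiM I (\<lambda>_. M))"
    unfolding G_def by measurable
  \<comment> \<open>On extensional points membership in a box is a coordinatewise condition, so the
    indicator factors and both integrals split into products.\<close>
  have box: "indicator (PiE I A) y = (\<Prod>i\<in>I. indicator (A i) (y i) :: ennreal)"
    if "y \<in> extensional I" for A y
  proof (cases "\<forall>i\<in>I. y i \<in> A i")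
    case False
    then obtain i where "i \<in> I" "y i \<notin> A i" by auto
    then have "y \<notin> PiE I A" "(\<Prod>i\<in>I. indicator (A i) (y i) :: ennreal) = 0"
      using I by (auto simp: PiE_def intro!: prod_zero bexI[of _ i])
    then show ?thesis by simp
  qed (use that in \<open>auto simp: PiE_def\<close>)
  have sets: "sets (PiM I (\<lambda>_. density M v)) = sets (PiM I (\<lambda>_. M))"
    by (rule sets_PiM_cong) auto
  have emD: "emeasure (density M v) A = (\<integral>\<^sup>+y. v y * indicator A y \<partial>M)" if "A \<in> sets M" for A
    using that by (simp add: emeasure_density)
  have 1: "density (PiM I (\<lambda>_. M)) (\<lambda>y. \<Prod>i\<in>I. v (y i)) = PiM I (\<lambda>_. density M v)"
  proof (rule D.PiM_eqI[OF I])
    fix A assume A: "\<And>i. i \<in> I \<Longrightarrow> A i \<in> sets (density M v)"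
    then have A': "\<And>i. i \<in> I \<Longrightarrow> A i \<in> sets M" by simp
    have "emeasure (density (PiM I (\<lambda>_. M)) (\<lambda>y. \<Prod>i\<in>I. v (y i))) (PiE I A)
       = (\<integral>\<^sup>+y. (\<Prod>i\<in>I. v (y i)) * indicator (PiE I A) y \<partial>PiM I (\<lambda>_. M))"
      using A' I by (intro emeasure_density) (auto intro!: sets_PiM_I_finite)
    also have "\<dots> = (\<integral>\<^sup>+y. (\<Prod>i\<in>I. v (y i) * indicator (A i) (y i)) \<partial>PiM I (\<lambda>_. M))"
      by (intro nn_integral_cong) (simp add: box space_PiM PiE_iff prod.distrib)
    also have "\<dots> = (\<Prod>i\<in>I. \<integral>\<^sup>+y. v y * indicator (A i) y \<partial>M)"
      using A' by (intro M.product_nn_integral_prod[OF I]) auto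
    finally show "emeasure (density (PiM I (\<lambda>_. M)) (\<lambda>y. \<Prod>i\<in>I. v (y i))) (PiE I A)
        = (\<Prod>i\<in>I. emeasure (density M v) (A i))"
      using A' by (simp add: emD)
  qed (simp add: sets)
  have 2: "distr (density (PiM I (\<lambda>_. N)) (\<lambda>x. \<Prod>i\<in>I. w (x i))) (PiM I (\<lambda>_. M)) G
      = PiM I (\<lambda>_. density M v)"
  proof (rule D.PiM_eqI[OF I])
    fix A assume A: "\<And>i. i \<in> I \<Longrightarrow> A i \<in> sets (density M v)"
    then have A'[measurable]: "\<And>i. i \<in> I \<Longrightarrow> A i \<in> sets M" by simp
    have B: "PiE I A \<in> sets (PiM I (\<lambda>_. M))" using A' I by (auto intro!: sets_PiM_I_finite)
    have "emeasure (distr (density (PiM I (\<lambda>_. N)) (\<lambda>x. \<Prod>i\<in>I. w (x i))) (PiM I (\<lambda>_. M)) G) (PiE I A)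
       = (\<integral>\<^sup>+x. (\<Prod>i\<in>I. w (x i)) * indicator (G -` PiE I A \<inter> space (PiM I (\<lambda>_. N))) x \<partial>PiM I (\<lambda>_. N))"
      using B by (subst emeasure_distr) (auto simp: emeasure_density)
    also have "\<dots> = (\<integral>\<^sup>+x. (\<Prod>i\<in>I. w (x i)) * indicator (PiE I A) (G x) \<partial>PiM I (\<lambda>_. N))"
      by (intro nn_integral_cong) (auto split: split_indicator)
    also have "\<dots> = (\<integral>\<^sup>+x. (\<Prod>i\<in>I. w (x i) * indicator (A i) (g (x i))) \<partial>PiM I (\<lambda>_. N))"
      by (intro nn_integral_cong) (simp add: box G_def prod.distrib)
    also have "\<dots> = (\<Prod>i\<in>I. \<integral>\<^sup>+x. w x * indicator (A i) (g x) \<partial>N)"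
      by (intro N.product_nn_integral_prod[OF I]) measurable
    also have "\<dots> = (\<Prod>i\<in>I. emeasure (density M v) (A i))"
      using A' by (simp add: emD eq)
    finally show "emeasure (distr (density (PiM I (\<lambda>_. N)) (\<lambda>x. \<Prod>i\<in>I. w (x i))) (PiM I (\<lambda>_. M)) G) (PiE I A)
        = (\<Prod>i\<in>I. emeasure (density M v) (A i))" .
  qed (simp add: sets)
  have "(\<integral>\<^sup>+y. (\<Prod>i\<in>I. v (y i)) * F y \<partial>PiM I (\<lambda>_. M)) = integral\<^sup>N (PiM I (\<lambda>_. density M v)) F"
    unfolding 1[symmetric] by (subst nn_integral_density) auto
  also have "\<dots> = (\<integral>\<^sup>+x. (\<Prod>i\<in>I. w (x i)) * F (G x) \<partial>PiM I (\<lambda>_. N))"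
    unfolding 2[symmetric] by (subst nn_integral_distr) (auto simp: nn_integral_density)
  finally show ?thesis by (simp add: G_def)
qed

section \<open>Angles modulo \<open>2 * pi\<close>\<close>

definition wrap :: "real \<Rightarrow> real" where
  "wrap x = x - 2 * pi * of_int \<lfloor>x / (2*pi)\<rfloor>"

lemma wrap_unique:
  assumes "0 \<le> x - 2 * pi * of_int n" "x - 2 * pi * of_int n < 2 * pi"
  shows "\<lfloor>x / (2*pi)\<rfloor> = n"
proof -
  have "of_int n \<le> x / (2*pi)" using assms(1) by (simp add: le_divide_eq mult.commute)
  moreover have "x / (2*pi) < of_int n + 1" using assms(2) by (simp add: divide_less_eq algebra_simps)
  ultimately show ?thesis by (simp add: floor_unique)
qed

lemma wrap_range: "0 \<le> wrap x" "wrap x < 2 * pi"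
proof -
  have "of_int \<lfloor>x / (2*pi)\<rfloor> \<le> x / (2*pi)" by linarith
  then have "2*pi * of_int \<lfloor>x / (2*pi)\<rfloor> \<le> x" by (simp add: le_divide_eq mult.commute)
  moreover have "x / (2*pi) < of_int \<lfloor>x / (2*pi)\<rfloor> + 1" by linarith
  from mult_strict_left_mono[OF this, of "2*pi"]
  have "x < 2*pi * (of_int \<lfloor>x / (2*pi)\<rfloor> + 1)" by simp
  ultimately show "0 \<le> wrap x" "wrap x < 2 * pi" unfolding wrap_def by (simp_all add: distrib_left)
qed

lemma cos_wrap: "cos (wrap x + a) = cos (x + a)" "cos (wrap x - a) = cos (x - a)" "cos (wrap x) = cos x"
proof -
  have *: "cos (y - 2 * pi * of_int n) = cos y" for y and n :: int
    by (simp add: cos_diff cos_int_2pin sin_int_2pin)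
  from *[of "x + a" "\<lfloor>x / (2*pi)\<rfloor>"] *[of "x - a" "\<lfloor>x / (2*pi)\<rfloor>"] *[of x "\<lfloor>x / (2*pi)\<rfloor>"]
  show "cos (wrap x + a) = cos (x + a)" "cos (wrap x - a) = cos (x - a)" "cos (wrap x) = cos x"
    by (simp_all add: wrap_def algebra_simps)
qed

text \<open>Since \<open>d < 1\<close>, only shifts of the window by \<open>-1\<close>,
  \<open>0\<close> or \<open>1\<close> periods meet \<open>[0, 2 pi)\<close>, and they are disjoint.
  Both sides become sums of three integrals, which agree term by term by translation
  invariance.\<close>

lemma nn_integral_wrap:
  assumes t: "0 \<le> t" "t < 2 * pi" and d: "0 < d" "d < 1" and A: "A \<in> sets borel" "A \<subseteq> {0..<2*pi}"
  shows "(\<integral>\<^sup>+y. indicator {y. \<exists>n::int. \<bar>y - t - 2 * pi * of_int n\<bar> < d} y * indicator A y \<partial>lborel)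
       = (\<integral>\<^sup>+x. indicator {-d<..<d} x * indicator A (wrap (t + x)) \<partial>lborel)"
proof -
  have [measurable]: "A \<in> sets borel" by fact
  note pi3 = pi_gt3
  \<comment> \<open>Here \<open>n\<close> counts the periods that \<open>wrap\<close> removes, hence
    the minus sign; in the window condition on the left-hand side the sign is opposite.\<close>
  define g :: "int \<Rightarrow> real \<Rightarrow> ennreal" where
    "g = (\<lambda>n y. indicator {t - 2 * pi * of_int n - d <..< t - 2 * pi * of_int n + d} y * indicator A y)"
  have [measurable]: "g n \<in> borel_measurable borel" for n unfolding g_def by measurable
  have 1: "indicator {-d<..<d} x * indicator A (wrap (t + x)) = (\<Sum>n\<in>{-1,0,1}. g n (t - 2 * pi * of_int n + x))" for x
  proof (cases "x \<in> {-d<..<d}")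
    case True
    then have x: "- d < x" "x < d" by auto
    define n0 where "n0 = \<lfloor>(t + x) / (2*pi)\<rfloor>"
    have w: "wrap (t + x) = t + x - 2 * pi * of_int n0" by (simp add: wrap_def n0_def)
    have "real_of_int n0 < 2"
    proof (rule ccontr)
      assume "\<not> ?thesis"
      then have "2 * pi * 2 \<le> 2 * pi * of_int n0" by (intro mult_left_mono) auto
      then show False using wrap_range(1)[of "t + x", unfolded w] x t d pi3 by linarith
    qed
    moreover have "real_of_int n0 > - 2"
    proof (rule ccontr)
      assume "\<not> ?thesis"
      then have "2 * pi * of_int n0 \<le> 2 * pi * (-2)" by (intro mult_left_mono) auto
      then show False using wrap_range(2)[of "t + x", unfolded w] x t d pi3 by linarith
    qed
    ultimately have n0: "n0 \<in> {-1,0,1}" by auto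
    have "g n (t - 2 * pi * of_int n + x) = (if n = n0 then indicator A (wrap (t + x)) else 0)" for n
    proof (cases "t - 2 * pi * of_int n + x \<in> A")
      case a: True
      then have "0 \<le> t + x - 2 * pi * of_int n" "t + x - 2 * pi * of_int n < 2 * pi"
        using A(2) by (auto simp: algebra_simps)
      from wrap_unique[OF this] have "n = n0" by (simp add: n0_def)
      then show ?thesis using True by (auto simp: g_def w algebra_simps)
    next
      case False
      then show ?thesis using True by (auto simp: g_def w algebra_simps)
    qed
    then show ?thesis using True n0 by auto
  qed (auto simp: g_def)
  have 2: "indicator {y. \<exists>n::int. \<bar>y - t - 2 * pi * of_int n\<bar> < d} y * indicator A y = (\<Sum>n\<in>{-1,0,1}. g n y)" for y
  proof (cases "y \<in> A")
    case True
    then have y: "0 \<le> y" "y < 2 * pi" using A(2) by auto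
    show ?thesis
    proof (cases "\<exists>n::int. \<bar>y - t - 2 * pi * of_int n\<bar> < d")
      case ex: True
      then obtain n where n: "\<bar>y - t - 2 * pi * of_int n\<bar> < d" by auto
      have "real_of_int n < 2"
      proof (rule ccontr)
        assume "\<not> ?thesis"
        then have "2 * pi * 2 \<le> 2 * pi * of_int n" by (intro mult_left_mono) auto
        then show False using n y t d pi3 by linarith
      qed
      moreover have "real_of_int n > - 2"
      proof (rule ccontr)
        assume "\<not> ?thesis"
        then have "2 * pi * of_int n \<le> 2 * pi * (-2)" by (intro mult_left_mono) auto
        then show False using n y t d pi3 by linarith
      qed
      ultimately have "n \<in> {-1,0,1}" by auto
      then have n1: "- n \<in> {-1,0,1}" by auto
      have "g k y = (if k = - n then 1 else 0)" if "k \<in> {-1,0,1}" for k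
      proof (cases "k = - n")
        case True
        then have "y \<in> {t - 2 * pi * of_int k - d <..< t - 2 * pi * of_int k + d}"
          using n by (auto simp: abs_less_iff)
        then show ?thesis using True \<open>y \<in> A\<close> unfolding g_def by simp
      next
        case False
        \<comment> \<open>Distinct windows have centres at least \<open>2 * pi\<close> apart,
          whereas a common point would force this distance below \<open>2 * d < 2\<close>.\<close>
        have "g k y = 0"
        proof (rule ccontr)
          assume "g k y \<noteq> 0"
          then have "\<bar>y - t + 2 * pi * of_int k\<bar> < d" by (auto simp: g_def split: split_indicator_asm)
          then have lt: "\<bar>2 * pi * of_int (k + n)\<bar> < 2" using n d by (simp add: distrib_left)
          have "1 \<le> \<bar>k + n\<bar>" using False by auto
          then have "1 \<le> \<bar>real_of_int (k + n)\<bar>" by linarith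
          then have "2 * pi * 1 \<le> 2 * pi * \<bar>real_of_int (k + n)\<bar>" by (intro mult_left_mono) auto
          then show False using lt pi3 by (simp only: abs_mult)
        qed
        then show ?thesis using False by simp
      qed
      then have "(\<Sum>k\<in>{-1,0,1}. g k y) = (\<Sum>k\<in>{-1,0,1}. if k = - n then 1 else 0)"
        by (intro sum.cong) auto
      also have "\<dots> = 1" using n1 by (subst sum.delta) auto
      finally show ?thesis using ex True by (simp add: indicator_def)
    next
      case nex: False
      have "g k y = 0" for k
        using nex[unfolded not_ex, rule_format, of "-k"] by (auto simp: g_def split: split_indicator)
      then show ?thesis using nex by simp
    qed
  qed (auto simp: g_def)
  have 3: "(\<integral>\<^sup>+x. g n (t - 2 * pi * of_int n + x) \<partial>lborel) = (\<integral>\<^sup>+y. g n y \<partial>lborel)" for n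
    by (subst (2) nn_integral_real_affine[where c = 1 and t = "t - 2 * pi * of_int n"]) auto
  show ?thesis
    unfolding 1 2 by (subst (1 2) nn_integral_sum) (auto simp: 3)
qed

section \<open>The arctangent contraction onto the window\<close>

definition squash :: "real \<Rightarrow> real \<Rightarrow> real" where
  "squash c x = arctan (c * x) / c"

lemma squash_deriv:
  assumes "c > 0"
  shows "(squash c has_real_derivative 1 / (1 + (c * x)\<^sup>2)) (at x)"
proof -
  have "((\<lambda>x. arctan (c * x)) has_real_derivative c / (1 + (c * x)\<^sup>2)) (at x)"
    by (auto intro!: derivative_eq_intros simp: field_simps)
  from DERIV_cdivide[OF this, of c] show ?thesis
    using assms by (simp add: squash_def[abs_def])
qed

text \<open>The derivative \<open>1 / (1 + (c * x)\<^sup>2)\<close> is at most 1. This is what keeps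
  every squared difference in \<open>dirichlet\<close> from growing under the substitution.\<close>

lemma squash_contraction:
  assumes "c > 0"
  shows "\<bar>squash c x - squash c y\<bar> \<le> \<bar>x - y\<bar>"
proof -
  have "norm (squash c x - squash c y) \<le> 1 * norm (x - y)"
  proof (rule field_differentiable_bound[of UNIV])
    show "(squash c has_field_derivative 1 / (1 + (c * z)\<^sup>2)) (at z within UNIV)" for z
      using squash_deriv[OF assms] by simp
    show "norm (1 / (1 + (c * z)\<^sup>2)) \<le> 1" for z
      by (simp add: divide_le_eq add_pos_nonneg not_less)
  qed auto
  then show ?thesis by simp
qed

text \<open>The scale \<open>c\<close> is the one for which the bound \<open>pi / 2\<close> on
  \<open>arctan\<close> becomes \<open>d\<close> after division by \<open>c\<close>.\<close>

lemma squash_range: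
  assumes "d > 0" "c = pi / (2 * d)"
  shows "- d < squash c x" "squash c x < d"
proof -
  have "c > 0" "pi / 2 = d * c" using assms by simp_all
  then show "- d < squash c x" "squash c x < d"
    using arctan_bounded[of "c * x"] by (simp_all add: squash_def less_divide_eq divide_less_eq)
qed

text \<open>The substitution is made on compact intervals \<open>B n\<close>, whose images under the
  increasing map are the \<open>A n\<close>. These increase to the whole line and to the open
  window, and continuity of measures from below gives the limit.\<close>

lemma nn_integral_squash:
  fixes f :: "real \<Rightarrow> ennreal"
  assumes d: "d > 0" and c: "c = pi / (2 * d)" and f[measurable]: "f \<in> borel_measurable borel"
  shows "(\<integral>\<^sup>+x. indicator {-d<..<d} x * f x \<partial>lborel)
    = (\<integral>\<^sup>+x. ennreal (1 / (1 + (c * x)\<^sup>2)) * f (squash c x) \<partial>lborel)"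
proof -
  have c0: "c > 0" using d c by simp
  have mono: "squash c x \<le> squash c y" if "x \<le> y" for x y
    using that c0 by (simp add: squash_def divide_right_mono arctan_monotone')
  have [measurable]: "squash c \<in> borel_measurable borel"
    unfolding squash_def[abs_def] by measurable
  \<comment> \<open>\<open>Suc n\<close> keeps every interval nondegenerate, so that the
    substitution applies already at \<open>n = 0\<close>.\<close>
  define A where "A = (\<lambda>n::nat. {squash c (- real (Suc n))..squash c (real (Suc n))})"
  define B where "B = (\<lambda>n::nat. {- real (Suc n)..real (Suc n)})"
  have incA: "incseq A" unfolding A_def incseq_def
    by (intro allI impI atLeastatMost_subset_iff[THEN iffD2] disjI2 conjI mono) auto
  have incB: "incseq B" unfolding B_def incseq_def by auto
  have UB: "(\<Union>n. B n) = UNIV"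
  proof -
    have "\<exists>n. x \<in> B n" for x
    proof -
      obtain n where "\<bar>x\<bar> \<le> real n" using real_arch_simple by blast
      then have "x \<in> B n" by (auto simp: B_def)
      then show ?thesis by blast
    qed
    then show ?thesis by auto
  qed
  have UA: "(\<Union>n. A n) = {-d<..<d}"
  proof
    show "(\<Union>n. A n) \<subseteq> {-d<..<d}"
    proof
      fix x assume "x \<in> (\<Union>n. A n)"
      then obtain n where "squash c (- real (Suc n)) \<le> x" "x \<le> squash c (real (Suc n))"
        unfolding A_def by auto
      then show "x \<in> {-d<..<d}"
        using squash_range(1)[OF d c, of "- real (Suc n)"] squash_range(2)[OF d c, of "real (Suc n)"]
        by simp
    qed
    show "{-d<..<d} \<subseteq> (\<Union>n. A n)"
    proof
      fix y assume y: "y \<in> {-d<..<d}"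
      have cd: "c * d = pi / 2" using d c by simp
      have "c * (- d) < c * y" "c * y < c * d" using y c0 by (auto simp only: mult_less_cancel_left_pos greaterThanLessThan_iff)
      then have "- (pi/2) < c * y" "c * y < pi/2" using cd by auto
      then have sy: "squash c (tan (c * y) / c) = y" using c0 by (simp add: squash_def arctan_tan)
      obtain n where "tan (c * y) / c \<in> B n" using UB by blast
      then have "y \<in> A n" unfolding A_def B_def using mono sy by (metis atLeastAtMost_iff)
      then show "y \<in> (\<Union>n. A n)" by blast
    qed
  qed
  have step: "emeasure (density lborel f) (A n)
      = emeasure (density lborel (\<lambda>x. f (squash c x) * ennreal (1 / (1 + (c * x)\<^sup>2)))) (B n)" for n
    using nn_integral_substitution_aux[OF f _ squash_deriv[OF c0], of "- real (Suc n)" "real (Suc n)"]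
    by (simp add: A_def B_def emeasure_density continuous_intros add_nonneg_eq_0_iff)
  have "(\<integral>\<^sup>+x. f x * indicator (\<Union>n. A n) x \<partial>lborel) = emeasure (density lborel f) (\<Union>n. A n)"
    by (subst emeasure_density) (auto simp: A_def)
  also have "\<dots> = (SUP n. emeasure (density lborel f) (A n))"
    by (rule SUP_emeasure_incseq[OF _ incA, symmetric]) (auto simp: A_def)
  also have "\<dots> = (SUP n. emeasure (density lborel (\<lambda>x. f (squash c x) * ennreal (1 / (1 + (c * x)\<^sup>2)))) (B n))"
    unfolding step ..
  also have "\<dots> = emeasure (density lborel (\<lambda>x. f (squash c x) * ennreal (1 / (1 + (c * x)\<^sup>2)))) (\<Union>n. B n)"
    by (rule SUP_emeasure_incseq[OF _ incB]) (auto simp: B_def)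
  also have "\<dots> = (\<integral>\<^sup>+x. f (squash c x) * ennreal (1 / (1 + (c * x)\<^sup>2)) \<partial>lborel)"
    unfolding UB by (subst emeasure_density) auto
  finally show ?thesis unfolding UA by (simp add: mult.commute)
qed

subsection \<open>Comparison with the harmonic model\<close>

lemma shift_in_torus:
  assumes "r \<in> torus L"
  shows "shift1 L r \<in> torus L" "shift2 L r \<in> torus L" "shift3 L r \<in> torus L"
  using assms bij_betw_shift[of L] by (auto dest: bij_betwE)

lemma hamiltonian_measurable:
  assumes f: "\<And>r. r \<in> torus L \<Longrightarrow> (\<lambda>x. f x r) \<in> borel_measurable M"
  shows "(\<lambda>x. hamiltonian J L (f x)) \<in> borel_measurable M"
proof -
  have "(\<lambda>x. (cos (f x r) - cos (f x (shift1 L r)))\<^sup>2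
    + (cos (f x r - 2*pi/3) - cos (f x (shift2 L r) - 2*pi/3))\<^sup>2
    + (cos (f x r + 2*pi/3) - cos (f x (shift3 L r) + 2*pi/3))\<^sup>2) \<in> borel_measurable M"
    if "r \<in> torus L" for r
  proof -
    note [measurable] = f[OF that] shift_in_torus[OF that, THEN f]
    show ?thesis by measurable
  qed
  then show ?thesis unfolding hamiltonian_def by (intro borel_measurable_times borel_measurable_sum) auto
qed

lemma hamiltonian_wrap:
  "hamiltonian J L (\<lambda>r\<in>torus L. wrap (u r)) = hamiltonian J L u"
  unfolding hamiltonian_def
  by (intro arg_cong[where f = "(*) (J / 2)"] sum.cong) (simp_all add: shift_in_torus cos_wrap)

definition angular_window :: "real \<Rightarrow> real \<Rightarrow> real set" where
  "angular_window t d = {y. \<exists>n::int. \<bar>y - t - 2 * pi * of_int n\<bar> < d}"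

lemma angular_window_borel [measurable]: "angular_window t d \<in> sets borel"
proof -
  have "angular_window t d = (\<Union>n::int. {y. \<bar>y - t - 2 * pi * of_int n\<bar> < d})"
    by (auto simp: angular_window_def)
  also have "open \<dots>" by (intro open_UN ballI open_Collect_less continuous_intros)
  finally show ?thesis by simp
qed

lemma chi_eq_prod: "chi d t L \<theta> = (\<Prod>r\<in>torus L. indicator (angular_window t d) (\<theta> r))"
proof (cases "\<forall>r\<in>torus L. \<theta> r \<in> angular_window t d")
  case True
  then show ?thesis by (simp add: chi_def angular_window_def)
next
  case False
  then obtain r where "r \<in> torus L" "\<theta> r \<notin> angular_window t d" by auto
  then have "(\<Prod>r\<in>torus L. indicator (angular_window t d) (\<theta> r) :: real) = 0" "chi d t L \<theta> = 0"
    by (auto simp: chi_def angular_window_def intro!: prod_zero bexI[of _ r])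
  then show ?thesis by simp
qed

lemma config_component_measurable:
  assumes "r \<in> torus L"
  shows "(\<lambda>\<theta>. \<theta> r) \<in> borel_measurable (config_measure L)"
  unfolding config_measure_def
  by (rule measurable_compose[OF measurable_component_singleton[OF assms]])
     (auto intro!: measurable_restrict_space1)

text \<open>The weight \<open>w\<close> and the map \<open>h\<close> are left open because the upper
  bound uses the indicator of the window with the identity, and the lower bound the Jacobian with
  \<open>squash\<close>. The reduction of angles to \<open>[0, 2 pi)\<close> disappears since the
  Hamiltonian is periodic in each angle.\<close>

lemma partition_function_substitution:
  fixes w :: "real \<Rightarrow> ennreal"
  assumes t: "0 \<le> t" "t < 2 * pi" and d: "0 < d" "d < 1"
    and w[measurable]: "w \<in> borel_measurable borel" and h[measurable]: "h \<in> borel_measurable borel"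
    and eq: "\<And>f. f \<in> borel_measurable borel \<Longrightarrow>
      (\<integral>\<^sup>+x. indicator {-d<..<d} x * f x \<partial>lborel) = (\<integral>\<^sup>+x. w x * f (h x) \<partial>lborel)"
  shows "(\<integral>\<^sup>+\<theta>. ennreal (exp (- \<beta> * hamiltonian J L \<theta>) * chi d t L \<theta>) \<partial>config_measure L)
     = (\<integral>\<^sup>+x. (\<Prod>r\<in>torus L. w (x r)) * ennreal (exp (- \<beta> * hamiltonian J L (\<lambda>r. t + h (x r))))
          \<partial>PiM (torus L) (\<lambda>_. lborel))"
proof -
  define M where "M = restrict_space lborel {0..<2*pi}"
  define S where "S = angular_window t d"
  define v :: "real \<Rightarrow> ennreal" where "v = indicator S"
  define g where "g = (\<lambda>x. wrap (t + h x))"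
  define F where "F = (\<lambda>\<theta>. ennreal (exp (- \<beta> * hamiltonian J L \<theta>)))"
  have S[measurable]: "S \<in> sets borel" by (simp add: S_def)
  have [measurable]: "wrap \<in> borel_measurable borel" unfolding wrap_def[abs_def] by measurable
  have M: "sigma_finite_measure M"
    unfolding M_def by (rule sigma_finite_measure_restrict_space) (auto intro: lborel.sigma_finite_measure_axioms)
  have v: "v \<in> borel_measurable M"
    unfolding M_def v_def by (rule measurable_restrict_space1) measurable
  have D: "sigma_finite_measure (density M v)"
    using sigma_finite_measure.sigma_finite_iff_density_finite[OF M v] by (auto simp: v_def indicator_def)
  have g: "g \<in> measurable lborel M"
    unfolding M_def g_def by (rule measurable_restrict_space2) (use wrap_range in auto)
  have F: "F \<in> borel_measurable (PiM (torus L) (\<lambda>_. M))"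
  proof -
    note [measurable] = hamiltonian_measurable[OF config_component_measurable,
        unfolded config_measure_def, folded M_def, where J = J]
    show ?thesis unfolding F_def by measurable
  qed
  have vw: "(\<integral>\<^sup>+y. v y * indicator A y \<partial>M) = (\<integral>\<^sup>+x. w x * indicator A (g x) \<partial>lborel)"
    if "A \<in> sets M" for A
  proof -
    have A: "A \<in> sets borel" "A \<subseteq> {0..<2*pi}"
      using that by (auto simp: M_def sets_restrict_space)
    note [measurable] = A(1)
    have "(\<integral>\<^sup>+y. v y * indicator A y \<partial>M) = (\<integral>\<^sup>+y. v y * indicator A y * indicator {0..<2*pi} y \<partial>lborel)"
      unfolding M_def by (rule nn_integral_restrict_space) auto
    also have "\<dots> = (\<integral>\<^sup>+y. indicator S y * indicator A y \<partial>lborel)"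
      using A(2) by (intro nn_integral_cong) (auto simp: v_def split: split_indicator)
    also have "\<dots> = (\<integral>\<^sup>+x. indicator {-d<..<d} x * indicator A (wrap (t + x)) \<partial>lborel)"
      unfolding S_def angular_window_def by (rule nn_integral_wrap[OF t d A])
    also have "\<dots> = (\<integral>\<^sup>+x. w x * indicator A (g x) \<partial>lborel)"
      unfolding g_def by (rule eq) measurable
    finally show ?thesis .
  qed
  have "ennreal (exp (- \<beta> * hamiltonian J L \<theta>) * chi d t L \<theta>) = (\<Prod>r\<in>torus L. v (\<theta> r)) * F \<theta>" for \<theta>
  proof -
    have "(\<Prod>r\<in>torus L. v (\<theta> r)) = ennreal (chi d t L \<theta>)"
      by (simp add: v_def S_def chi_eq_prod prod_ennreal[symmetric] ennreal_indicator)
    then show ?thesis by (simp add: F_def ennreal_mult'' mult.commute)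
  qed
  then have "(\<integral>\<^sup>+\<theta>. ennreal (exp (- \<beta> * hamiltonian J L \<theta>) * chi d t L \<theta>) \<partial>config_measure L)
      = (\<integral>\<^sup>+\<theta>. (\<Prod>r\<in>torus L. v (\<theta> r)) * F \<theta> \<partial>PiM (torus L) (\<lambda>_. M))"
    by (simp add: config_measure_def M_def)
  also have "\<dots> = (\<integral>\<^sup>+x. (\<Prod>r\<in>torus L. w (x r)) * F (\<lambda>r\<in>torus L. g (x r)) \<partial>PiM (torus L) (\<lambda>_. lborel))"
    by (rule PiM_nn_integral_substitution[OF finite_torus M lborel.sigma_finite_measure_axioms D v _ g vw F]) simp
  finally show ?thesis
    unfolding F_def g_def hamiltonian_wrap .
qed

text \<open>By the mean value theorem the difference of cosines is
  \<open>(y - x) * sin (a + z)\<close> with \<open>z\<close> between \<open>x\<close> and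
  \<open>y\<close>. Replacing the square of \<open>sin (a + z)\<close> by that of
  \<open>sin a\<close> costs at most \<open>2 * d\<close>, and \<open>(x - y)\<^sup>2\<close> is at
  most \<open>4 * d\<^sup>2\<close>.\<close>

lemma cos_diff_square_expand:
  fixes a d x y :: real
  assumes x: "\<bar>x\<bar> \<le> d" and y: "\<bar>y\<bar> \<le> d"
  shows "\<bar>(cos (a + x) - cos (a + y))\<^sup>2 - (sin a)\<^sup>2 * (x - y)\<^sup>2\<bar> \<le> 8 * d ^ 3"
proof -
  have main: "\<bar>(cos (a + x) - cos (a + y))\<^sup>2 - (sin a)\<^sup>2 * (x - y)\<^sup>2\<bar> \<le> 8 * d ^ 3"
    if xy: "x < y" and x: "\<bar>x\<bar> \<le> d" and y: "\<bar>y\<bar> \<le> d" for x y :: real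
  proof -
    have "\<exists>z. x < z \<and> z < y \<and> cos (a + y) - cos (a + x) = (y - x) * (- sin (a + z))"
      by (rule MVT2[OF xy]) (auto intro!: derivative_eq_intros)
    then obtain z where z: "x < z" "z < y" "cos (a + y) - cos (a + x) = (y - x) * (- sin (a + z))" by auto
    then have zd: "\<bar>z\<bar> \<le> d" using x y by auto
    have "\<bar>sin (a + z) - sin a\<bar> \<le> d"
    proof -
      have "norm (sin (a + z) - sin a) \<le> 1 * norm (a + z - a)"
        by (rule field_differentiable_bound[of UNIV _ cos]) (auto intro!: derivative_eq_intros)
      then show ?thesis using zd by simp
    qed
    moreover have "\<bar>sin (a + z) + sin a\<bar> \<le> 2"
      using abs_sin_le_one[of a] abs_sin_le_one[of "a + z"] by linarith
    ultimately have s: "\<bar>(sin (a + z) - sin a) * (sin (a + z) + sin a)\<bar> \<le> d * 2"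
      unfolding abs_mult by (intro mult_mono) auto
    have "(x - y)\<^sup>2 \<le> (2 * d)\<^sup>2"
      using x y by (intro abs_le_square_iff[THEN iffD1]) auto
    then have s2: "\<bar>(x - y)\<^sup>2\<bar> \<le> 4 * d\<^sup>2" by (simp add: power_mult_distrib)
    have cz: "cos (a + x) - cos (a + y) = (y - x) * sin (a + z)" using z(3) by simp
    have "(cos (a + x) - cos (a + y))\<^sup>2 - (sin a)\<^sup>2 * (x - y)\<^sup>2
       = ((sin (a + z) - sin a) * (sin (a + z) + sin a)) * (x - y)\<^sup>2"
      unfolding cz by (simp add: power2_eq_square algebra_simps)
    also have "\<bar>\<dots>\<bar> \<le> (d * 2) * (4 * d\<^sup>2)"
      unfolding abs_mult[of _ "(x - y)\<^sup>2"] using s s2 by (intro mult_mono) auto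
    finally show ?thesis by (simp add: power2_eq_square power3_eq_cube mult_ac)
  qed
  show ?thesis
  proof (cases x y rule: linorder_cases)
    case less
    then show ?thesis by (rule main[OF _ x y])
  next
    case equal
    then show ?thesis using x by simp
  next
    case greater
    then show ?thesis using main[OF _ y x] by (simp add: power2_commute)
  qed
qed

definition stiffness :: "real \<Rightarrow> real \<times> real \<times> real" where
  "stiffness t = ((sin t)\<^sup>2, (sin (t - 2*pi/3))\<^sup>2, (sin (t + 2*pi/3))\<^sup>2)"

lemma stiffness_nonneg: "fst (stiffness t) \<ge> 0" "fst (snd (stiffness t)) \<ge> 0" "snd (snd (stiffness t)) \<ge> 0"
  by (simp_all add: stiffness_def)

text \<open>Three bonds per site each carry an error of at most \<open>8 * d ^ 3\<close>; the
  prefactor \<open>J / 2\<close> turns 24 into 12.\<close>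

lemma hamiltonian_harmonic:
  assumes J: "J > 0" and x: "\<And>r. r \<in> torus L \<Longrightarrow> \<bar>x r\<bar> \<le> d"
  shows "\<bar>hamiltonian J L (\<lambda>r. t + x r) - J / 2 * dirichlet (stiffness t) L x\<bar> \<le> 12 * J * d ^ 3 * real L ^ 3"
proof -
  define e where "e = (\<lambda>a y z. (cos (a + y) - cos (a + z))\<^sup>2 - (sin a)\<^sup>2 * (y - z)\<^sup>2 :: real)"
  have "hamiltonian J L (\<lambda>r. t + x r) - J / 2 * dirichlet (stiffness t) L x
    = J / 2 * (\<Sum>r\<in>torus L. e t (x r) (x (shift1 L r)) + e (t - 2*pi/3) (x r) (x (shift2 L r))
        + e (t + 2*pi/3) (x r) (x (shift3 L r)))"
    unfolding hamiltonian_def dirichlet_def right_diff_distrib[symmetric] sum_subtractf[symmetric]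
    by (intro arg_cong[where f = "(*) (J / 2)"] sum.cong) (auto simp: e_def stiffness_def algebra_simps)
  also have "\<bar>\<dots>\<bar> \<le> J / 2 * (real (card (torus L)) * (24 * d ^ 3))"
  proof -
    have "\<bar>\<Sum>r\<in>torus L. e t (x r) (x (shift1 L r)) + e (t - 2*pi/3) (x r) (x (shift2 L r))
        + e (t + 2*pi/3) (x r) (x (shift3 L r))\<bar> \<le> (\<Sum>r\<in>torus L. 24 * d ^ 3)"
    proof (rule order_trans[OF sum_abs], rule sum_mono)
      fix r assume r: "r \<in> torus L"
      note xr = x[OF r] shift_in_torus[OF r, THEN x]
      have "\<bar>e t (x r) (x (shift1 L r))\<bar> \<le> 8 * d ^ 3" "\<bar>e (t - 2*pi/3) (x r) (x (shift2 L r))\<bar> \<le> 8 * d ^ 3"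
        "\<bar>e (t + 2*pi/3) (x r) (x (shift3 L r))\<bar> \<le> 8 * d ^ 3"
        unfolding e_def using xr by (simp_all only: cos_diff_square_expand)
      then show "\<bar>e t (x r) (x (shift1 L r)) + e (t - 2*pi/3) (x r) (x (shift2 L r))
        + e (t + 2*pi/3) (x r) (x (shift3 L r))\<bar> \<le> 24 * d ^ 3" by linarith
    qed
    then show ?thesis using J by (simp add: abs_mult mult_left_mono)
  qed
  finally show ?thesis by (simp add: card_torus mult_ac)
qed

definition log_gaussian :: "real \<Rightarrow> real \<Rightarrow> real \<Rightarrow> nat \<Rightarrow> real" where
  "log_gaussian t b m L = - (real L ^ 3) / 2 * ln (b / (2*pi))
     - (\<Sum>j\<in>torus L. ln (dispersion (stiffness t) (torus_momentum L j) + m)) / 2"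

text \<open>On the window, a factor
  \<open>exp (\<beta> * J * m * (d\<^sup>2 - (x r)\<^sup>2) / 2)\<close> at every site can only
  increase the integrand. It inserts the mass at a cost of
  \<open>\<beta> * J * m * d\<^sup>2 / 2\<close> per site, after which the window is dropped. The
  mass remains a free parameter.\<close>

lemma partition_function_upper:
  assumes t: "0 \<le> t" "t < 2 * pi" and d: "0 < d" "d < 1" and J: "J > 0" and \<beta>: "\<beta> > 0"
    and m: "m > 0" and L: "L > 0"
  shows "(\<integral>\<^sup>+\<theta>. ennreal (exp (- \<beta> * hamiltonian J L \<theta>) * chi d t L \<theta>) \<partial>config_measure L)
    \<le> ennreal (exp (real L ^ 3 * (12 * (\<beta> * J) * d ^ 3 + \<beta> * J * m * d\<^sup>2 / 2) + log_gaussian t (\<beta> * J) m L))"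
proof -
  define C where "C = real L ^ 3 * (12 * (\<beta> * J) * d ^ 3 + \<beta> * J * m * d\<^sup>2 / 2)"
  define G where "G = (\<lambda>x. exp (- (\<beta> * J / 2) * (dirichlet (stiffness t) L x + m * (\<Sum>r\<in>torus L. (x r)\<^sup>2))))"
  have "(\<integral>\<^sup>+\<theta>. ennreal (exp (- \<beta> * hamiltonian J L \<theta>) * chi d t L \<theta>) \<partial>config_measure L)
     = (\<integral>\<^sup>+x. (\<Prod>r\<in>torus L. indicator {-d<..<d} (x r)) * ennreal (exp (- \<beta> * hamiltonian J L (\<lambda>r. t + x r)))
          \<partial>PiM (torus L) (\<lambda>_. lborel))"
    by (rule partition_function_substitution[OF t d]) auto
  also have "\<dots> \<le> (\<integral>\<^sup>+x. ennreal (exp C) * ennreal (G x) \<partial>PiM (torus L) (\<lambda>_. lborel))"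
  proof (rule nn_integral_mono)
    fix x :: "nat \<times> nat \<times> nat \<Rightarrow> real"
    show "(\<Prod>r\<in>torus L. indicator {-d<..<d} (x r)) * ennreal (exp (- \<beta> * hamiltonian J L (\<lambda>r. t + x r)))
       \<le> ennreal (exp C) * ennreal (G x)"
    proof (cases "\<forall>r\<in>torus L. x r \<in> {-d<..<d}")
      case False
      then obtain r where "r \<in> torus L" "x r \<notin> {-d<..<d}" by blast
      then have "(\<Prod>r\<in>torus L. indicator {-d<..<d} (x r) :: ennreal) = 0"
        by (intro prod_zero bexI[of _ r]) auto
      then show ?thesis by (simp only: mult_zero_left zero_le)
    next
      case True
      then have xd: "\<bar>x r\<bar> \<le> d" if "r \<in> torus L" for r using that by (auto simp: abs_le_iff less_imp_le)
      have "\<bar>hamiltonian J L (\<lambda>r. t + x r) - J / 2 * dirichlet (stiffness t) L x\<bar> \<le> 12 * J * d ^ 3 * real L ^ 3"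
        by (rule hamiltonian_harmonic[OF J xd])
      then have "J / 2 * dirichlet (stiffness t) L x - 12 * J * d ^ 3 * real L ^ 3 \<le> hamiltonian J L (\<lambda>r. t + x r)"
        by linarith
      then have 1: "\<beta> * (J / 2 * dirichlet (stiffness t) L x - 12 * J * d ^ 3 * real L ^ 3) \<le> \<beta> * hamiltonian J L (\<lambda>r. t + x r)"
        using \<beta> by (intro mult_left_mono) auto
      have "(\<Sum>r\<in>torus L. (x r)\<^sup>2) \<le> (\<Sum>r\<in>torus L. d\<^sup>2)"
        using xd by (intro sum_mono abs_le_square_iff[THEN iffD1]) (use d in auto)
      then have "\<beta> * J / 2 * m * (\<Sum>r\<in>torus L. (x r)\<^sup>2) \<le> \<beta> * J / 2 * m * (real L ^ 3 * d\<^sup>2)"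
        using \<beta> J m by (intro mult_left_mono) (auto simp: card_torus)
      then have "- \<beta> * hamiltonian J L (\<lambda>r. t + x r) \<le> C + - (\<beta> * J / 2) * (dirichlet (stiffness t) L x + m * (\<Sum>r\<in>torus L. (x r)\<^sup>2))"
        using 1 by (simp add: C_def algebra_simps)
      then have "exp (- \<beta> * hamiltonian J L (\<lambda>r. t + x r)) \<le> exp C * G x"
        unfolding G_def exp_add[symmetric] by simp
      then show ?thesis using True by (simp add: ennreal_mult[symmetric] G_def)
    qed
  qed
  also have "\<dots> = ennreal (exp C) * (\<integral>\<^sup>+x. ennreal (G x) \<partial>PiM (torus L) (\<lambda>_. lborel))"
    by (rule nn_integral_cmult) (auto simp: G_def dirichlet_def shift_in_torus)
  also have "\<dots> = ennreal (exp C) * ennreal (exp (log_gaussian t (\<beta> * J) m L))"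
    unfolding G_def log_gaussian_def
    using massive_gaussian_integral[OF L _ m stiffness_nonneg[of t], of "\<beta> * J"] \<beta> J by simp
  finally show ?thesis unfolding C_def by (simp add: ennreal_mult[symmetric] exp_add)
qed

text \<open>After the \<open>squash\<close> substitution three pointwise estimates combine: the
  cubic error at the squashed field, the contraction of the gradient energy, and the Gaussian lower
  bound on the Jacobian. The last one dictates the mass.\<close>

lemma partition_function_lower:
  assumes t: "0 \<le> t" "t < 2 * pi" and d: "0 < d" "d < 1" and J: "J > 0" and \<beta>: "\<beta> > 0"
    and m: "m = pi\<^sup>2 / (2 * (\<beta> * J * d\<^sup>2))" and L: "L > 0"
  shows "ennreal (exp (log_gaussian t (\<beta> * J) m L - real L ^ 3 * (12 * (\<beta> * J) * d ^ 3)))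
    \<le> (\<integral>\<^sup>+\<theta>. ennreal (exp (- \<beta> * hamiltonian J L \<theta>) * chi d t L \<theta>) \<partial>config_measure L)"
proof -
  define C where "C = real L ^ 3 * (12 * (\<beta> * J) * d ^ 3)"
  define c where "c = pi / (2 * d)"
  have c0: "c > 0" using d by (simp add: c_def)
  have m0: "m > 0" using m \<beta> J d by simp
  \<comment> \<open>The origin of the value of \<open>m\<close>: the mass term of the Gaussian has
    to match the exponent \<open>(c * x)\<^sup>2\<close> that bounds the Jacobian.\<close>
  have mc: "\<beta> * J / 2 * m = c\<^sup>2"
    using \<beta> J d by (simp add: m c_def power2_eq_square field_simps)
  define G where "G = (\<lambda>x. exp (- (\<beta> * J / 2) * (dirichlet (stiffness t) L x + m * (\<Sum>r\<in>torus L. (x r)\<^sup>2))))"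
  have "ennreal (exp (log_gaussian t (\<beta> * J) m L - C)) = ennreal (exp (- C)) * ennreal (exp (log_gaussian t (\<beta> * J) m L))"
    by (simp add: ennreal_mult[symmetric] exp_add[symmetric])
  also have "\<dots> = ennreal (exp (- C)) * (\<integral>\<^sup>+x. ennreal (G x) \<partial>PiM (torus L) (\<lambda>_. lborel))"
    unfolding G_def log_gaussian_def
    using massive_gaussian_integral[OF L _ m0 stiffness_nonneg[of t], of "\<beta> * J"] \<beta> J by simp
  also have "\<dots> = (\<integral>\<^sup>+x. ennreal (exp (- C)) * ennreal (G x) \<partial>PiM (torus L) (\<lambda>_. lborel))"
    by (rule nn_integral_cmult[symmetric]) (auto simp: G_def dirichlet_def shift_in_torus)
  also have "\<dots> \<le> (\<integral>\<^sup>+x. (\<Prod>r\<in>torus L. ennreal (1 / (1 + (c * x r)\<^sup>2)))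
      * ennreal (exp (- \<beta> * hamiltonian J L (\<lambda>r. t + squash c (x r)))) \<partial>PiM (torus L) (\<lambda>_. lborel))"
  proof (rule nn_integral_mono)
    fix x :: "nat \<times> nat \<times> nat \<Rightarrow> real"
    define y where "y = (\<lambda>r. squash c (x r))"
    have yd: "\<bar>y r\<bar> \<le> d" for r
      using squash_range[OF d(1) c_def, of "x r"] by (simp add: y_def abs_le_iff)
    have "\<bar>hamiltonian J L (\<lambda>r. t + y r) - J / 2 * dirichlet (stiffness t) L y\<bar> \<le> 12 * J * d ^ 3 * real L ^ 3"
      by (rule hamiltonian_harmonic[OF J yd])
    then have "hamiltonian J L (\<lambda>r. t + y r) \<le> J / 2 * dirichlet (stiffness t) L y + 12 * J * d ^ 3 * real L ^ 3"
      by linarith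
    moreover have "dirichlet (stiffness t) L y \<le> dirichlet (stiffness t) L x"
      unfolding dirichlet_def y_def
      by (intro sum_mono add_mono mult_left_mono stiffness_nonneg abs_le_square_iff[THEN iffD1] squash_contraction c0)
    then have "J / 2 * dirichlet (stiffness t) L y \<le> J / 2 * dirichlet (stiffness t) L x"
      using J by (intro mult_left_mono) auto
    ultimately have "hamiltonian J L (\<lambda>r. t + y r) \<le> J / 2 * dirichlet (stiffness t) L x + 12 * J * d ^ 3 * real L ^ 3"
      by linarith
    then have 1: "\<beta> * hamiltonian J L (\<lambda>r. t + y r) \<le> \<beta> * (J / 2 * dirichlet (stiffness t) L x + 12 * J * d ^ 3 * real L ^ 3)"
      using \<beta> by (intro mult_left_mono) auto
    have 2: "exp (- (c\<^sup>2 * (\<Sum>r\<in>torus L. (x r)\<^sup>2))) \<le> (\<Prod>r\<in>torus L. 1 / (1 + (c * x r)\<^sup>2))"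
    proof -
      have "exp (- (c\<^sup>2 * (\<Sum>r\<in>torus L. (x r)\<^sup>2))) = (\<Prod>r\<in>torus L. exp (- (c * x r)\<^sup>2))"
        by (simp add: exp_sum[symmetric] sum_negf sum_distrib_left power_mult_distrib)
      also have "\<dots> \<le> (\<Prod>r\<in>torus L. 1 / (1 + (c * x r)\<^sup>2))"
      proof (intro prod_mono conjI)
        fix r
        have "1 + (c * x r)\<^sup>2 \<le> exp ((c * x r)\<^sup>2)" by (rule exp_ge_add_one_self)
        moreover have "1 + (c * x r)\<^sup>2 > 0" by (simp add: add_pos_nonneg)
        ultimately show "exp (- (c * x r)\<^sup>2) \<le> 1 / (1 + (c * x r)\<^sup>2)"
          by (simp add: exp_minus inverse_eq_divide frac_le)
      qed simp
      finally show ?thesis .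
    qed
    have "exp (- C) * G x = exp (- (c\<^sup>2 * (\<Sum>r\<in>torus L. (x r)\<^sup>2))) * exp (- C - \<beta> * J / 2 * dirichlet (stiffness t) L x)"
      unfolding G_def exp_add[symmetric] mc[symmetric] by (simp add: algebra_simps)
    also have "\<dots> \<le> (\<Prod>r\<in>torus L. 1 / (1 + (c * x r)\<^sup>2)) * exp (- \<beta> * hamiltonian J L (\<lambda>r. t + y r))"
    proof (rule mult_mono[OF 2])
      show "exp (- C - \<beta> * J / 2 * dirichlet (stiffness t) L x) \<le> exp (- \<beta> * hamiltonian J L (\<lambda>r. t + y r))"
        using 1 by (simp add: C_def algebra_simps)
    qed (auto intro!: prod_nonneg)
    finally have "ennreal (exp (- C) * G x) \<le> ennreal ((\<Prod>r\<in>torus L. 1 / (1 + (c * x r)\<^sup>2)) * exp (- \<beta> * hamiltonian J L (\<lambda>r. t + y r)))"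
      by (rule ennreal_leI)
    then show "ennreal (exp (- C)) * ennreal (G x) \<le> (\<Prod>r\<in>torus L. ennreal (1 / (1 + (c * x r)\<^sup>2)))
      * ennreal (exp (- \<beta> * hamiltonian J L (\<lambda>r. t + squash c (x r))))"
      unfolding y_def by (subst prod_ennreal) (simp_all add: ennreal_mult prod_nonneg G_def)
  qed
  also have "\<dots> = (\<integral>\<^sup>+\<theta>. ennreal (exp (- \<beta> * hamiltonian J L \<theta>) * chi d t L \<theta>) \<partial>config_measure L)"
    by (rule partition_function_substitution[OF t d _ _ nn_integral_squash[OF d(1) c_def], symmetric])
       (simp_all add: squash_def[abs_def])
  finally show ?thesis unfolding C_def .
qed

subsection \<open>Riemann sums over the Brillouin zone\<close>

abbreviation brillouin :: "(real \<times> real \<times> real) set" where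
  "brillouin \<equiv> {-pi..pi} \<times> {-pi..pi} \<times> {-pi..pi}"

lemma brillouin_finite: "brillouin \<in> sets lborel" "emeasure lborel brillouin < \<infinity>"
proof -
  show "brillouin \<in> sets lborel" unfolding lborel_prod[symmetric] by measurable
  show "emeasure lborel brillouin < \<infinity>"
    by (intro emeasure_bounded_finite bounded_Times) auto
qed

lemma AE_lborel_inner_neq:
  fixes a :: "'a::euclidean_space"
  assumes "a \<noteq> 0"
  shows "AE k in lborel. inner a k \<noteq> c"
proof -
  have "{x. inner a x = c} \<in> null_sets lebesgue"
    using negligible_hyperplane[of a c] assms by (simp add: negligible_iff_null_sets)
  then have "{x. inner a x = c} \<in> null_sets lborel"
    by (subst (asm) null_sets_completion_iff) (auto intro!: borel_closed closed_hyperplane)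
  from AE_not_in[OF this] show ?thesis by simp
qed

text \<open>Serves twice: with \<open>c = pi\<close> it removes faces of the zone, with
  \<open>c = 0\<close> the planes on which \<open>singular_majorant\<close> is singular.\<close>

lemma AE_lborel_coordinates_neq:
  "AE k :: real \<times> real \<times> real in lborel. fst k \<noteq> c \<and> fst (snd k) \<noteq> c \<and> snd (snd k) \<noteq> c"
  using AE_lborel_inner_neq[of "(1,0,0) :: real \<times> real \<times> real" c]
    AE_lborel_inner_neq[of "(0,1,0) :: real \<times> real \<times> real" c]
    AE_lborel_inner_neq[of "(0,0,1) :: real \<times> real \<times> real" c]
  by (auto simp: inner_prod_def zero_prod_def)

text \<open>Half-open, so that the cells with \<open>i < L\<close> partition
  \<open>[-pi, pi)\<close>. The momentum with label \<open>i\<close> is the left end of its cell for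
  even \<open>L\<close> and the midpoint for odd \<open>L\<close>.\<close>

definition cell :: "nat \<Rightarrow> nat \<Rightarrow> real set" where
  "cell L i = {- pi + 2 * pi * real i / real L ..< - pi + 2 * pi * (real i + 1) / real L}"

lemma cell_iff:
  assumes "L > 0" "- pi \<le> x"
  shows "x \<in> cell L i \<longleftrightarrow> i = nat \<lfloor>(x + pi) * real L / (2*pi)\<rfloor>"
proof -
  define y where "y = (x + pi) * real L / (2*pi)"
  have y0: "0 \<le> y" using assms by (simp add: y_def)
  have x: "x = - pi + 2 * pi * y / real L" using assms by (simp add: y_def)
  have m: "2 * pi * a / real L \<le> 2 * pi * b / real L \<longleftrightarrow> a \<le> b"
          "2 * pi * a / real L < 2 * pi * b / real L \<longleftrightarrow> a < b" for a b :: real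
    using assms by (simp_all add: divide_le_cancel divide_less_cancel)
  have "x \<in> cell L i \<longleftrightarrow> real i \<le> y \<and> y < real i + 1"
    unfolding cell_def x by (simp add: m)
  also have "\<dots> \<longleftrightarrow> \<lfloor>y\<rfloor> = int i" by (auto simp: floor_eq_iff)
  also have "\<dots> \<longleftrightarrow> i = nat \<lfloor>y\<rfloor>" using y0 by auto
  finally show ?thesis by (simp add: y_def)
qed

lemma cell_index_bound:
  assumes "L > 0" "- pi \<le> x" "x < pi"
  shows "nat \<lfloor>(x + pi) * real L / (2*pi)\<rfloor> < L"
proof -
  have "(x + pi) * real L < (2 * pi) * real L" using assms by (intro mult_strict_right_mono) auto
  then have "(x + pi) * real L / (2*pi) < real L" by (simp add: divide_less_eq mult.commute)
  then have "\<lfloor>(x + pi) * real L / (2*pi)\<rfloor> < int L" by (simp add: floor_less_iff)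
  then show ?thesis using assms by simp
qed

lemma cell_momentum:
  assumes "L > 0" "x \<in> cell L i"
  shows "\<bar>momentum L i - x\<bar> \<le> 2 * pi / real L"
proof -
  \<comment> \<open>The offset of the momentum from the left end in units of the cell width,
    \<open>0\<close> or \<open>1/2\<close> by the parity of \<open>L\<close>.\<close>
  define e where "e = real L / 2 - real (L div 2)"
  have e: "0 \<le> e" "e \<le> 1"
  proof -
    have "L = 2 * (L div 2) + L mod 2" by simp
    then have "real L = 2 * real (L div 2) + real (L mod 2)" by (metis of_nat_add of_nat_mult of_nat_numeral)
    moreover have "real (L mod 2) \<le> 1" by simp
    ultimately show "0 \<le> e" "e \<le> 1" unfolding e_def by linarith+
  qed
  have "momentum L i = - pi + 2 * pi * real i / real L + 2 * pi / real L * e"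
    using assms(1) by (simp add: momentum_def e_def field_simps)
  moreover have "0 \<le> 2 * pi / real L * e" "2 * pi / real L * e \<le> 2 * pi / real L * 1"
    using e by (intro mult_nonneg_nonneg mult_left_mono; simp)+
  moreover have "- pi + 2 * pi * real i / real L \<le> x" "x < - pi + 2 * pi * real i / real L + 2 * pi / real L"
    using assms(2) by (auto simp: cell_def add_divide_distrib distrib_left)
  ultimately show ?thesis by (simp add: abs_le_iff)
qed

lemma cell_subset:
  assumes "i < L"
  shows "cell L i \<subseteq> {-pi..<pi}"
proof -
  have "2 * pi * (real i + 1) / real L \<le> 2 * pi * real L / real L"
    using assms by (intro divide_right_mono mult_left_mono) auto
  then have "2 * pi * (real i + 1) / real L \<le> 2 * pi" using assms by simp
  moreover have "0 \<le> 2 * pi * real i / real L" by simp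
  ultimately show ?thesis unfolding cell_def by auto
qed

text \<open>The normalised sum is the integral of a step function \<open>G L\<close>, which on each
  cell takes the value of \<open>g\<close> at the momentum of that cell. Continuity of
  \<open>g\<close> gives pointwise convergence, and its bound gives domination by a constant on the
  zone.\<close>

lemma riemann_sum_torus:
  fixes g :: "real \<times> real \<times> real \<Rightarrow> real"
  assumes cont: "continuous_on UNIV g" and bound: "\<And>k. \<bar>g k\<bar> \<le> B"
  shows "(\<lambda>L. (\<Sum>j\<in>torus L. g (torus_momentum L j)) / real L ^ 3)
     \<longlonglongrightarrow> (LINT k : brillouin | lborel. g k) / (2*pi) ^ 3"
proof -
  define C where "C = (\<lambda>L j. cell L (fst j) \<times> cell L (fst (snd j)) \<times> cell L (snd (snd j)))"
  define G where "G = (\<lambda>L k. \<Sum>j\<in>torus L. indicator (C L j) k * g (torus_momentum L j))"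
  have gm[measurable]: "g \<in> borel_measurable borel"
    using cont by (rule borel_measurable_continuous_onI)
  have Cm[measurable]: "C L j \<in> sets borel" for L j
    unfolding C_def cell_def borel_prod[symmetric] by measurable
  have emC: "emeasure lborel (C L j) = ennreal ((2 * pi / real L) ^ 3)" for L j
  proof -
    have e: "emeasure lborel (cell L i) = ennreal (2 * pi / real L)" for i
    proof -
      have "2 * pi * real i / real L \<le> 2 * pi * (real i + 1) / real L"
        by (intro divide_right_mono mult_left_mono) auto
      then show ?thesis
        by (simp add: cell_def add_divide_distrib distrib_left)
    qed
    have [measurable]: "cell L i \<in> sets borel" for i by (simp add: cell_def)
    have prod: "emeasure lborel (A \<times> A') = emeasure lborel A * emeasure lborel A'"
      if "A \<in> sets borel" "A' \<in> sets borel"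
      for A :: "real set" and A' :: "'b::euclidean_space set"
      unfolding lborel_prod[symmetric] using that by (intro lborel.emeasure_pair_measure_Times) auto
    have "cell L (fst (snd j)) \<times> cell L (snd (snd j)) \<in> sets borel"
      unfolding borel_prod[symmetric] by simp
    then have "emeasure lborel (C L j) = emeasure lborel (cell L (fst j)) *
        (emeasure lborel (cell L (fst (snd j))) * emeasure lborel (cell L (snd (snd j))))"
      unfolding C_def by (simp add: prod)
    then show ?thesis by (simp add: e ennreal_mult[symmetric] power3_eq_cube mult_ac)
  qed
  have intG: "integral\<^sup>L lborel (G L) = (2*pi) ^ 3 * ((\<Sum>j\<in>torus L. g (torus_momentum L j)) / real L ^ 3)" for L
  proof -
    have "integral\<^sup>L lborel (G L) = (\<Sum>j\<in>torus L. (2 * pi / real L) ^ 3 * g (torus_momentum L j))"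
      unfolding G_def by (subst Bochner_Integration.integral_sum) (auto simp: emC measure_def)
    also have "\<dots> = (2*pi) ^ 3 * ((\<Sum>j\<in>torus L. g (torus_momentum L j)) / real L ^ 3)"
      by (simp only: sum_distrib_left[symmetric] power_divide) simp
    finally show ?thesis .
  qed
  \<comment> \<open>Each of the three coordinates is off by at most \<open>2 * pi / real L\<close>,
    and the norm is at most the sum of the three.\<close>
  have Gin: "\<exists>p. G L k = g p \<and> dist p k \<le> 6 * pi / real L"
    if L: "L > 0" and k: "k \<in> {-pi..<pi} \<times> {-pi..<pi} \<times> {-pi..<pi}" for L k
  proof -
    define ix where "ix = (\<lambda>x. nat \<lfloor>(x + pi) * real L / (2*pi)\<rfloor>)"
    define j where "j = (ix (fst k), ix (fst (snd k)), ix (snd (snd k)))"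
    have kk: "- pi \<le> fst k" "fst k < pi" "- pi \<le> fst (snd k)" "fst (snd k) < pi"
       "- pi \<le> snd (snd k)" "snd (snd k) < pi" using k by auto
    have jT: "j \<in> torus L"
      using cell_index_bound[OF L] kk by (auto simp: j_def torus_def ix_def)
    have kC: "k \<in> C L i \<longleftrightarrow> i = j" for i
      unfolding C_def mem_Times_iff
      by (simp add: cell_iff[OF L] kk j_def ix_def prod_eq_iff)
    have "G L k = (\<Sum>i\<in>torus L. if i = j then g (torus_momentum L i) else 0)"
      unfolding G_def by (intro sum.cong) (auto simp: indicator_def kC)
    also have "\<dots> = g (torus_momentum L j)" using jT by simp
    finally have "G L k = g (torus_momentum L j)" .
    moreover have "dist (torus_momentum L j) k \<le> 6 * pi / real L"
    proof -
      have "k \<in> C L j" using kC by simp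
      then have m: "\<bar>momentum L (fst j) - fst k\<bar> \<le> 2 * pi / real L"
        "\<bar>momentum L (fst (snd j)) - fst (snd k)\<bar> \<le> 2 * pi / real L"
        "\<bar>momentum L (snd (snd j)) - snd (snd k)\<bar> \<le> 2 * pi / real L"
        using cell_momentum[OF L] by (auto simp: C_def)
      have n1: "norm z \<le> norm (fst z) + norm (snd z)" for z :: "real \<times> real \<times> real"
        using norm_Pair_le[of "fst z" "snd z"] by simp
      have n2: "norm z \<le> norm (fst z) + norm (snd z)" for z :: "real \<times> real"
        using norm_Pair_le[of "fst z" "snd z"] by simp
      have "dist (torus_momentum L j) k \<le> norm (fst (torus_momentum L j - k))
          + norm (snd (torus_momentum L j - k))"
        unfolding dist_norm by (rule n1)
      also have "\<dots> \<le> norm (fst (torus_momentum L j - k))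
          + (norm (fst (snd (torus_momentum L j - k))) + norm (snd (snd (torus_momentum L j - k))))"
        by (intro add_left_mono n2)
      finally show ?thesis using m by (simp add: torus_momentum_def)
    qed
    ultimately show ?thesis by blast
  qed
  have Gout: "G L k = 0" if "k \<notin> {-pi..<pi} \<times> {-pi..<pi} \<times> {-pi..<pi}" for L k
    unfolding G_def
  proof (rule sum.neutral, rule ballI)
    fix j assume "j \<in> torus L"
    then have "C L j \<subseteq> {-pi..<pi} \<times> {-pi..<pi} \<times> {-pi..<pi}"
      unfolding C_def by (intro Sigma_mono cell_subset) (auto simp: torus_def)
    then show "indicator (C L j) k * g (torus_momentum L j) = 0" using that by (auto simp: indicator_def)
  qed
  have lim: "(\<lambda>L. G L k) \<longlonglongrightarrow> g k" if k: "k \<in> {-pi..<pi} \<times> {-pi..<pi} \<times> {-pi..<pi}" for k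
  proof -
    have "\<forall>L. \<exists>p. L > 0 \<longrightarrow> G L k = g p \<and> dist p k \<le> 6 * pi / real L"
      using Gin[OF _ k] by blast
    then obtain p where p: "\<And>L. L > 0 \<Longrightarrow> G L k = g (p L) \<and> dist (p L) k \<le> 6 * pi / real L" by metis
    have "(\<lambda>L. 6 * pi / real L) \<longlonglongrightarrow> 0" by (rule lim_const_over_n)
    then have "p \<longlonglongrightarrow> k"
      by (rule metric_tendsto_imp_tendsto[of _ 0 _ p k, simplified])
         (auto intro!: eventually_sequentiallyI[of 1] simp: p)
    moreover have "isCont g k" using cont continuous_on_eq_continuous_at[OF open_UNIV, of g] by blast
    ultimately have "(\<lambda>L. g (p L)) \<longlonglongrightarrow> g k" by (metis isCont_tendsto_compose)
    then show ?thesis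
      by (rule Lim_transform_eventually) (auto intro!: eventually_sequentiallyI[of 1] simp: p)
  qed
  have Bnn: "0 \<le> B" using bound[of 0] abs_ge_zero order_trans by blast
  have [measurable]: "brillouin \<in> sets borel" using brillouin_finite(1) by simp
  have "(\<lambda>L. integral\<^sup>L lborel (G L)) \<longlonglongrightarrow> integral\<^sup>L lborel (\<lambda>k. indicator brillouin k * g k)"
  proof (rule integral_dominated_convergence)
    show "integrable lborel (\<lambda>k. B * indicator brillouin k)" using brillouin_finite(2) by simp
    \<comment> \<open>The half-open cells miss the faces on which a coordinate equals
      \<open>pi\<close>; these are null.\<close>
    show "AE k in lborel. (\<lambda>L. G L k) \<longlonglongrightarrow> indicator brillouin k * g k"
      using AE_lborel_coordinates_neq[of pi]
    proof eventually_elim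
      case (elim k)
      show ?case
      proof (cases "k \<in> brillouin")
        case True
        then have "k \<in> {-pi..<pi} \<times> {-pi..<pi} \<times> {-pi..<pi}" using elim by (auto simp: mem_Times_iff)
        from lim[OF this] show ?thesis using True by simp
      next
        case False
        then have "k \<notin> {-pi..<pi} \<times> {-pi..<pi} \<times> {-pi..<pi}" by (auto simp: mem_Times_iff)
        then show ?thesis using False by (simp add: Gout)
      qed
    qed
    show "AE k in lborel. norm (G L k) \<le> B * indicator brillouin k" for L
    proof (rule AE_I2)
      fix k :: "real \<times> real \<times> real"
      show "norm (G L k) \<le> B * indicator brillouin k"
      proof (cases "k \<in> {-pi..<pi} \<times> {-pi..<pi} \<times> {-pi..<pi} \<and> L > 0")
        case True
        then have "k \<in> brillouin" by (auto simp: mem_Times_iff)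
        moreover obtain p where "G L k = g p" using Gin True by blast
        ultimately show ?thesis using bound by simp
      next
        case False
        \<comment> \<open>For \<open>L = 0\<close> the torus is empty, so \<open>G 0\<close>
          vanishes identically.\<close>
        then have "G L k = 0" using Gout[of k L] by (cases "L > 0") (auto simp: G_def torus_def)
        then show ?thesis using Bnn by simp
      qed
    qed
    show "(\<lambda>k. indicator brillouin k * g k) \<in> borel_measurable lborel" by measurable
    show "G L \<in> borel_measurable lborel" for L unfolding G_def by measurable
  qed
  then have "(\<lambda>L. (2*pi) ^ 3 * ((\<Sum>j\<in>torus L. g (torus_momentum L j)) / real L ^ 3) / (2*pi) ^ 3)
     \<longlonglongrightarrow> (LINT k : brillouin | lborel. g k) / (2*pi) ^ 3"
    unfolding intG set_lebesgue_integral_def by (intro tendsto_divide tendsto_const) auto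
  then show ?thesis by simp
qed

subsection \<open>The massless limit\<close>

lemma integrable_lborel_pair_mult:
  fixes f :: "'a::euclidean_space \<Rightarrow> real" and g :: "'b::euclidean_space \<Rightarrow> real"
  assumes f: "integrable lborel f" and g: "integrable lborel g"
  shows "integrable lborel (\<lambda>k. f (fst k) * g (snd k))"
proof -
  have [measurable]: "f \<in> borel_measurable borel" "g \<in> borel_measurable borel"
    using f g by (auto dest: borel_measurable_integrable)
  have "integrable (lborel \<Otimes>\<^sub>M lborel) (\<lambda>k. f (fst k) * g (snd k))"
  proof (rule lborel_pair.Fubini_integrable)
    show "integrable lborel (\<lambda>x. \<integral>y. norm (f (fst (x, y)) * g (snd (x, y))) \<partial>lborel)"
      using f by (simp add: abs_mult)
    show "AE x in lborel. integrable lborel (\<lambda>y. f (fst (x, y)) * g (snd (x, y)))"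
      using g by simp
  qed measurable
  then show ?thesis by (simp add: lborel_prod)
qed

text \<open>The power rule on \<open>[0, pi]\<close> and a reflection give gauge integrability;
  since the integrand is nonnegative, absolute and hence Lebesgue integrability follow.\<close>

lemma integrable_inverse_sqrt:
  "integrable lborel (\<lambda>x. indicator {-pi..pi} x * \<bar>x\<bar> powr (-1/2) :: real)"
proof -
  define f where "f = (\<lambda>x::real. \<bar>x\<bar> powr (-1/2))"
  have "(\<lambda>x. x powr (-1/2)) integrable_on {0..pi}" by (rule integrable_on_powr_from_0) auto
  then have 1: "f integrable_on {0..pi}"
    by (rule integrable_eq) (auto simp: f_def)
  have "(\<lambda>x. f (- x)) integrable_on {- pi..- 0} \<longleftrightarrow> f integrable_on {0..pi}"
    by (rule Henstock_Kurzweil_Integration.integrable_reflect_real)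
  moreover have "(\<lambda>x. f (- x)) = f" by (simp add: f_def)
  ultimately have 2: "f integrable_on {-pi..0}" using 1 by simp
  have "f integrable_on {-pi..pi}"
    by (rule Henstock_Kurzweil_Integration.integrable_combine[OF _ _ 2 1]) auto
  then have "f absolutely_integrable_on {-pi..pi}"
    by (rule nonnegative_absolutely_integrable_1) (auto simp: f_def)
  then have "integrable lebesgue (\<lambda>x. indicator {-pi..pi} x * f x)"
    by (simp add: set_integrable_def)
  then show ?thesis
    by (subst (asm) integrable_completion) (auto simp: f_def)
qed

text \<open>A sum over all three coordinates, because the direction that controls the dispersion
  changes with the angle \<open>t\<close>; the sum is a majorant independent of
  \<open>t\<close>.\<close>

definition singular_majorant :: "real \<times> real \<times> real \<Rightarrow> real" where
  "singular_majorant k = \<bar>fst k\<bar> powr (-1/2) + \<bar>fst (snd k)\<bar> powr (-1/2) + \<bar>snd (snd k)\<bar> powr (-1/2)"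

lemma set_integrable_singular_majorant: "set_integrable lborel brillouin singular_majorant"
proof -
  define u where "u = (\<lambda>x::real. indicator {-pi..pi} x * \<bar>x\<bar> powr (-1/2))"
  define e where "e = (\<lambda>x::real. indicator {-pi..pi} x :: real)"
  have u: "integrable lborel u" unfolding u_def by (rule integrable_inverse_sqrt)
  have e: "integrable lborel e" unfolding e_def by simp
  have "integrable lborel (\<lambda>k. u (fst k) * (e (fst (snd k)) * e (snd (snd k))))"
       "integrable lborel (\<lambda>k. e (fst k) * (u (fst (snd k)) * e (snd (snd k))))"
       "integrable lborel (\<lambda>k. e (fst k) * (e (fst (snd k)) * u (snd (snd k))))"
    using integrable_lborel_pair_mult[OF u integrable_lborel_pair_mult[OF e e]]
      integrable_lborel_pair_mult[OF e integrable_lborel_pair_mult[OF u e]]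
      integrable_lborel_pair_mult[OF e integrable_lborel_pair_mult[OF e u]] by auto
  then have "integrable lborel (\<lambda>k. u (fst k) * (e (fst (snd k)) * e (snd (snd k)))
      + e (fst k) * (u (fst (snd k)) * e (snd (snd k))) + e (fst k) * (e (fst (snd k)) * u (snd (snd k))))"
    by (intro Bochner_Integration.integrable_add)
  also have "(\<lambda>k. u (fst k) * (e (fst (snd k)) * e (snd (snd k)))
      + e (fst k) * (u (fst (snd k)) * e (snd (snd k))) + e (fst k) * (e (fst (snd k)) * u (snd (snd k))))
     = (\<lambda>k. indicator brillouin k *\<^sub>R singular_majorant k)"
    by (rule ext) (auto simp: u_def e_def singular_majorant_def indicator_def mem_Times_iff)
  finally show ?thesis unfolding set_integrable_def .
qed

section \<open>Lower bounds on the dispersion\<close>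

lemma sin_ge_half:
  assumes "0 \<le> y" "y \<le> pi / 2"
  shows "y / 2 \<le> sin y"
proof -
  \<comment> \<open>Halving the angle gives \<open>sin y = 2 * sin z * cos z\<close>, which is at
    least \<open>2 * z * (cos z)\<^sup>2\<close>, and \<open>(cos z)\<^sup>2\<close> is at least
    \<open>1/2\<close> up to \<open>pi / 4\<close>.\<close>
  define z where "z = y / 2"
  have z: "0 \<le> z" "z \<le> pi / 4" using assms by (auto simp: z_def)
  have c: "sqrt 2 / 2 \<le> cos z"
    using cos_monotone_0_pi_le[of z "pi/4"] z pi_gt_zero by (simp add: cos_45)
  then have c2: "1 / 2 \<le> (cos z)\<^sup>2"
    using power_mono[OF c, of 2] by (simp add: power_divide)
  have s: "z * cos z \<le> sin z"
  proof (cases "z = 0")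
    case False
    then have "0 < z" using z by simp
    then have "\<exists>x. 0 < x \<and> x < z \<and> sin z - sin 0 = (z - 0) * cos x"
      by (rule MVT2) (auto intro!: derivative_eq_intros)
    then obtain x where x: "0 < x" "x < z" "sin z = z * cos x" by auto
    have "cos z \<le> cos x" using x z pi_gt_zero by (intro cos_monotone_0_pi_le) auto
    then show ?thesis using x z by (simp add: mult_left_mono)
  qed simp
  have "0 \<le> cos z" using c by (rule order_trans[rotated]) simp
  have "y / 2 = 2 * z * (1/2)" by (simp add: z_def)
  also have "\<dots> \<le> 2 * z * (cos z)\<^sup>2" using c2 z by (intro mult_left_mono) auto
  also have "\<dots> = 2 * (z * cos z) * cos z" by (simp add: power2_eq_square)
  also have "\<dots> \<le> 2 * sin z * cos z"
    using s \<open>0 \<le> cos z\<close> by (intro mult_right_mono mult_left_mono) auto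
  also have "\<dots> = sin y" using sin_double[of z] by (simp add: z_def)
  finally show ?thesis .
qed

lemma one_minus_cos_ge:
  assumes "\<bar>x\<bar> \<le> pi"
  shows "x\<^sup>2 / 8 \<le> 1 - cos x"
proof -
  have "\<bar>x\<bar> / 2 / 2 \<le> sin (\<bar>x\<bar> / 2)" by (rule sin_ge_half) (use assms in auto)
  then have "(\<bar>x\<bar> / 2 / 2)\<^sup>2 \<le> (sin (\<bar>x\<bar> / 2))\<^sup>2" by (rule power_mono) simp
  moreover have "cos x = 1 - 2 * (sin (\<bar>x\<bar> / 2))\<^sup>2"
    using cos_double_sin[of "\<bar>x\<bar> / 2"] by simp
  ultimately show ?thesis by (simp add: power_divide)
qed

text \<open>Guarantees that for every \<open>t\<close> some stiffness is at least
  \<open>1/2\<close>, and caps the dispersion from above.\<close>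

lemma stiffness_sum: "fst (stiffness t) + fst (snd (stiffness t)) + snd (snd (stiffness t)) = 3 / 2"
proof -
  have "(sin (t - 2*pi/3))\<^sup>2 + (sin (t + 2*pi/3))\<^sup>2 = (sin t)\<^sup>2 / 2 + 3 / 2 * (cos t)\<^sup>2"
    unfolding sin_diff sin_add cos_120 sin_120
    by (simp add: power2_eq_square algebra_simps)
  then show ?thesis
    unfolding stiffness_def fst_conv snd_conv using sin_cos_squared_add[of t] by linarith
qed

text \<open>The three stiffnesses average \<open>1/2\<close>, so one of them is at least that. Its
  term alone is at least \<open>1 - cos x\<close>, hence at least \<open>x\<^sup>2 / 8\<close>, and
  the other two terms are nonnegative.\<close>

lemma dispersion_lower:
  assumes "k \<in> brillouin"
  shows "\<exists>x\<in>{fst k, fst (snd k), snd (snd k)}. x\<^sup>2 / 8 \<le> dispersion (stiffness t) k"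
proof -
  obtain q1 q2 q3 where q: "stiffness t = (q1, q2, q3)" by (metis prod_cases3)
  obtain k1 k2 k3 where k: "k = (k1, k2, k3)" by (metis prod_cases3)
  have q0: "0 \<le> q1" "0 \<le> q2" "0 \<le> q3" "q1 + q2 + q3 = 3/2"
    using stiffness_nonneg[of t] stiffness_sum[of t] by (auto simp: q)
  have kb: "\<bar>k1\<bar> \<le> pi" "\<bar>k2\<bar> \<le> pi" "\<bar>k3\<bar> \<le> pi" using assms by (auto simp: k abs_le_iff)
  have low: "x\<^sup>2 / 8 \<le> p * (2 - 2 * cos x)" if "1/2 \<le> p" "\<bar>x\<bar> \<le> pi" for p x :: real
  proof -
    have "x\<^sup>2 / 8 \<le> 1/2 * (2 - 2 * cos x)" using one_minus_cos_ge[OF that(2)] by simp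
    also have "\<dots> \<le> p * (2 - 2 * cos x)" using that by (intro mult_right_mono) auto
    finally show ?thesis .
  qed
  have nn: "0 \<le> p * (2 - 2 * cos x)" if "0 \<le> p" for p x :: real using that by simp
  have D: "dispersion (stiffness t) k = q1 * (2 - 2 * cos k1) + q2 * (2 - 2 * cos k2) + q3 * (2 - 2 * cos k3)"
    by (simp add: dispersion_def q k)
  consider "1/2 \<le> q1" | "1/2 \<le> q2" | "1/2 \<le> q3" using q0 by linarith
  then show ?thesis
  proof cases
    case 1
    have "k1\<^sup>2 / 8 \<le> dispersion (stiffness t) k"
      unfolding D using low[OF 1 kb(1)] nn[OF q0(2), of k2] nn[OF q0(3), of k3] by linarith
    then show ?thesis by (simp add: k)
  next
    case 2
    have "k2\<^sup>2 / 8 \<le> dispersion (stiffness t) k"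
      unfolding D using low[OF 2 kb(2)] nn[OF q0(1), of k1] nn[OF q0(3), of k3] by linarith
    then show ?thesis by (simp add: k)
  next
    case 3
    have "k3\<^sup>2 / 8 \<le> dispersion (stiffness t) k"
      unfolding D using low[OF 3 kb(3)] nn[OF q0(1), of k1] nn[OF q0(2), of k2] by linarith
    then show ?thesis by (simp add: k)
  qed
qed

text \<open>With \<open>u = x powr (1/4)\<close> one has \<open>1 + u ^ 4 \<le> (1 + u) ^ 4\<close>
  and \<open>ln (1 + u) \<le> u\<close>. The fourth root turns the singularity
  \<open>\<bar>x\<bar> powr (-2)\<close> into the integrable
  \<open>\<bar>x\<bar> powr (-1/2)\<close>.\<close>

lemma ln_one_plus_le_root4:
  fixes x :: real
  assumes "0 < x"
  shows "ln (1 + x) \<le> 4 * x powr (1/4)"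
proof -
  define u where "u = x powr (1/4)"
  have u: "0 < u" "u ^ 4 = x" using assms by (auto simp: u_def powr_powr simp flip: powr_realpow)
  have "1 + u ^ 4 \<le> (1 + u) ^ 4" using u by (simp add: power4_eq_xxxx algebra_simps)
  then have "ln (1 + x) \<le> ln ((1 + u) ^ 4)" using u assms by (subst ln_le_cancel_iff) auto
  also have "\<dots> = 4 * ln (1 + u)" using u by (simp add: ln_realpow)
  also have "\<dots> \<le> 4 * u" using u ln_add_one_self_le_self[of u] by simp
  finally show ?thesis by (simp add: u_def)
qed

text \<open>The gap is \<open>ln (1 + m / D)\<close>, and \<open>D\<close> is at least
  \<open>x\<^sup>2 / 8\<close> for one coordinate \<open>x\<close>, so the fourth-root bound yields
  \<open>(8 * m) powr (1/4) * \<bar>x\<bar> powr (-1/2)\<close>. All coordinate planes are excluded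
  because the controlling coordinate varies with \<open>t\<close>.\<close>

lemma ln_dispersion_gap:
  assumes k: "k \<in> brillouin" "fst k \<noteq> 0" "fst (snd k) \<noteq> 0" "snd (snd k) \<noteq> 0" and m: "m > 0"
  shows "0 < dispersion (stiffness t) k"
    and "ln (dispersion (stiffness t) k) \<le> ln (dispersion (stiffness t) k + m)"
    and "ln (dispersion (stiffness t) k + m) - ln (dispersion (stiffness t) k)
       \<le> 4 * (8 * m) powr (1/4) * singular_majorant k"
proof -
  define D where "D = dispersion (stiffness t) k"
  obtain x where x: "x \<in> {fst k, fst (snd k), snd (snd k)}" "x\<^sup>2 / 8 \<le> D"
    using dispersion_lower[OF k(1), of t] by (auto simp: D_def)
  have x0: "x \<noteq> 0" using x k by auto
  then have "0 < x\<^sup>2 / 8" by simp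
  with x(2) have D0: "0 < D" by linarith
  then show "0 < dispersion (stiffness t) k" by (simp add: D_def)
  show "ln (dispersion (stiffness t) k) \<le> ln (dispersion (stiffness t) k + m)"
    using D0 m by (simp add: D_def)
  have eq: "ln (D + m) - ln D = ln (1 + m / D)"
  proof -
    have "1 + m / D = (D + m) / D" using D0 by (simp add: add_divide_distrib)
    then show ?thesis using D0 m by (simp add: ln_div)
  qed
  have "(m / D) powr (1/4) \<le> (m / (x\<^sup>2 / 8)) powr (1/4)"
    using D0 m x x0 by (intro powr_mono2 divide_left_mono) auto
  also have "(m / (x\<^sup>2 / 8)) powr (1/4) = (8 * m) powr (1/4) * \<bar>x\<bar> powr (-1/2)"
  proof -
    have "\<bar>x\<bar> powr (-2) = 1 / x\<^sup>2"
      using x0 powr_realpow[of "\<bar>x\<bar>" 2] by (simp add: powr_minus divide_inverse)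
    then have "m / (x\<^sup>2 / 8) = (8 * m) * (\<bar>x\<bar> powr (-2))" by simp
    then have "(m / (x\<^sup>2 / 8)) powr (1/4) = (8 * m) powr (1/4) * (\<bar>x\<bar> powr (-2)) powr (1/4)"
      using m by (simp only: powr_mult)
    then show ?thesis by (simp only: powr_powr) simp
  qed
  finally have "(m / D) powr (1/4) \<le> (8 * m) powr (1/4) * \<bar>x\<bar> powr (-1/2)" .
  moreover have "\<bar>x\<bar> powr (-1/2) \<le> singular_majorant k"
  proof -
    have p: "0 \<le> y powr (-1/2)" for y :: real by simp
    show ?thesis
      using x(1) p[of "\<bar>fst k\<bar>"] p[of "\<bar>fst (snd k)\<bar>"] p[of "\<bar>snd (snd k)\<bar>"]
      unfolding singular_majorant_def by auto
  qed
  then have "(8 * m) powr (1/4) * \<bar>x\<bar> powr (-1/2) \<le> (8 * m) powr (1/4) * singular_majorant k"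
    by (intro mult_left_mono) auto
  moreover have "ln (1 + m / D) \<le> 4 * (m / D) powr (1/4)"
    using D0 m by (intro ln_one_plus_le_root4) simp
  ultimately show "ln (dispersion (stiffness t) k + m) - ln (dispersion (stiffness t) k)
       \<le> 4 * (8 * m) powr (1/4) * singular_majorant k"
    unfolding D_def[symmetric] eq by linarith
qed

section \<open>Logarithmic integrals with and without mass\<close>

lemma continuous_ln_dispersion:
  assumes "m > 0"
  shows "continuous_on UNIV (\<lambda>k. ln (dispersion (stiffness t) k + m))"
proof -
  have "dispersion (stiffness t) k + m \<noteq> 0" for k
    using dispersion_nonneg[OF stiffness_nonneg[of t], of k] assms by linarith
  then show ?thesis unfolding dispersion_def
    by (intro continuous_intros ballI) auto
qed

lemma ln_dispersion_bounded:
  assumes "m > 0"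
  shows "\<bar>ln (dispersion (stiffness t) k + m)\<bar> \<le> \<bar>ln m\<bar> + \<bar>ln (6 + m)\<bar>"
proof -
  define D where "D = dispersion (stiffness t) k"
  \<comment> \<open>Each \<open>2 - 2 * cos\<close> is at most 4, and the stiffnesses sum to
    \<open>3/2\<close>, whence the constant 6.\<close>
  have "D \<le> fst (stiffness t) * 4 + fst (snd (stiffness t)) * 4 + snd (snd (stiffness t)) * 4"
    unfolding D_def dispersion_def
    using cos_ge_minus_one[of "fst k"] cos_ge_minus_one[of "fst (snd k)"] cos_ge_minus_one[of "snd (snd k)"]
    by (intro add_mono mult_left_mono stiffness_nonneg; linarith)
  also have "\<dots> = 6" using stiffness_sum[of t] by simp
  finally have "D \<le> 6" .
  moreover have "0 \<le> D" unfolding D_def by (rule dispersion_nonneg[OF stiffness_nonneg])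
  ultimately have "ln m \<le> ln (D + m)" "ln (D + m) \<le> ln (6 + m)" using assms by auto
  then show ?thesis unfolding D_def by linarith
qed

lemma set_integrable_ln_dispersion_massive:
  assumes "m > 0"
  shows "set_integrable lborel brillouin (\<lambda>k. ln (dispersion (stiffness t) k + m))"
proof (rule set_integrable_bound)
  show "set_integrable lborel brillouin (\<lambda>_. \<bar>ln m\<bar> + \<bar>ln (6 + m)\<bar>)"
    using brillouin_finite by (simp add: set_integrable_def)
  show "set_borel_measurable lborel brillouin (\<lambda>k. ln (dispersion (stiffness t) k + m))"
    unfolding set_borel_measurable_def
    using borel_measurable_continuous_onI[OF continuous_ln_dispersion[OF assms, of t]] brillouin_finite(1)
    by (intro borel_measurable_scaleR) auto
qed (use ln_dispersion_bounded[OF assms] in auto)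

text \<open>The massless logarithm is the bounded logarithm with mass 1 minus the gap
  \<open>f\<close> between them, and \<open>ln_dispersion_gap\<close> dominates that gap almost
  everywhere.\<close>

lemma set_integrable_ln_dispersion:
  "set_integrable lborel brillouin (\<lambda>k. ln (dispersion (stiffness t) k))"
proof -
  define f where "f = (\<lambda>k. ln (dispersion (stiffness t) k + 1) - ln (dispersion (stiffness t) k))"
  have Dm[measurable]: "dispersion (stiffness t) \<in> borel_measurable borel"
    unfolding dispersion_def[abs_def] by (intro borel_measurable_continuous_onI continuous_intros)
  have "set_integrable lborel brillouin f"
  proof (rule set_integrable_bound)
    show "set_integrable lborel brillouin (\<lambda>k. 4 * (8 * 1) powr (1/4) * singular_majorant k)"
      using set_integrable_singular_majorant by (rule set_integrable_mult_right)
    show "set_borel_measurable lborel brillouin f"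
      unfolding set_borel_measurable_def f_def using brillouin_finite(1)
      by (intro borel_measurable_scaleR) auto
    show "AE k in lborel. k \<in> brillouin \<longrightarrow> norm (f k) \<le> norm (4 * (8 * 1) powr (1/4) * singular_majorant k)"
      using AE_lborel_coordinates_neq[of 0]
    proof eventually_elim
      case (elim k)
      show ?case
      proof
        assume "k \<in> brillouin"
        note gap = ln_dispersion_gap[OF this, where m = 1 and t = t]
        show "norm (f k) \<le> norm (4 * (8 * 1) powr (1/4) * singular_majorant k)"
          using gap(2,3) elim unfolding f_def real_norm_def by fastforce
      qed
    qed
  qed
  from set_integral_diff(1)[OF set_integrable_ln_dispersion_massive[of 1 t] this]
  show ?thesis by (simp add: f_def)
qed

definition spin_wave_integral :: "real \<Rightarrow> real \<Rightarrow> real" where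
  "spin_wave_integral t m = (LINT k : brillouin | lborel. ln (dispersion (stiffness t) k + m)) / (2*pi) ^ 3"

lemma spin_wave_free_energy_eq: "spin_wave_free_energy t = spin_wave_integral t 0 / 2"
proof -
  have c: "(cmod (1 - cis x))\<^sup>2 = 2 - 2 * cos x" for x
    unfolding cmod_power2 using sin_cos_squared_add[of x] by (simp add: power2_eq_square algebra_simps)
  show ?thesis
    by (simp add: spin_wave_free_energy_def spin_wave_integral_def Let_def c dispersion_def stiffness_def)
qed

text \<open>The constant in the rate of the massless limit, free of \<open>t\<close>. The factor 4
  comes from \<open>ln_one_plus_le_root4\<close>.\<close>

definition majorant_integral :: real where
  "majorant_integral = 4 * (LINT k : brillouin | lborel. singular_majorant k) / (2*pi) ^ 3"

text \<open>The gap bounds, integrated off the coordinate planes. The rate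
  \<open>(8 * m) powr (1/4)\<close> is uniform in \<open>t\<close>.\<close>

lemma spin_wave_integral_mass:
  assumes m: "m > 0"
  shows "spin_wave_integral t 0 \<le> spin_wave_integral t m"
    and "spin_wave_integral t m \<le> spin_wave_integral t 0 + (8 * m) powr (1/4) * majorant_integral"
proof -
  note i0 = set_integrable_ln_dispersion[of t] and im = set_integrable_ln_dispersion_massive[OF m, of t]
  have iS: "set_integrable lborel brillouin (\<lambda>k. 4 * (8 * m) powr (1/4) * singular_majorant k)"
    using set_integrable_singular_majorant by (rule set_integrable_mult_right)
  have "(LINT k : brillouin | lborel. ln (dispersion (stiffness t) k))
      \<le> (LINT k : brillouin | lborel. ln (dispersion (stiffness t) k + m))"
    by (rule set_integral_mono_AE[OF i0 im])
       (use AE_lborel_coordinates_neq[of 0] in eventually_elim, use ln_dispersion_gap(2)[OF _ _ _ _ m] in blast)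
  then show "spin_wave_integral t 0 \<le> spin_wave_integral t m"
    unfolding spin_wave_integral_def by (simp add: divide_right_mono)
  have "(LINT k : brillouin | lborel. ln (dispersion (stiffness t) k + m) - ln (dispersion (stiffness t) k))
      \<le> (LINT k : brillouin | lborel. 4 * (8 * m) powr (1/4) * singular_majorant k)"
    by (rule set_integral_mono_AE[OF set_integral_diff(1)[OF im i0] iS])
       (use AE_lborel_coordinates_neq[of 0] in eventually_elim, use ln_dispersion_gap(3)[OF _ _ _ _ m] in blast)
  also have "(LINT k : brillouin | lborel. ln (dispersion (stiffness t) k + m) - ln (dispersion (stiffness t) k))
      = (LINT k : brillouin | lborel. ln (dispersion (stiffness t) k + m))
        - (LINT k : brillouin | lborel. ln (dispersion (stiffness t) k))"
    by (rule set_integral_diff(2)[OF im i0])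
  finally have "(LINT k : brillouin | lborel. ln (dispersion (stiffness t) k + m))
      \<le> (LINT k : brillouin | lborel. ln (dispersion (stiffness t) k))
        + 4 * (8 * m) powr (1/4) * (LINT k : brillouin | lborel. singular_majorant k)" by simp
  from divide_right_mono[OF this, of "(2*pi) ^ 3"]
  show "spin_wave_integral t m \<le> spin_wave_integral t 0 + (8 * m) powr (1/4) * majorant_integral"
    unfolding spin_wave_integral_def majorant_integral_def
    by (simp only: add_divide_distrib) (simp add: mult_ac)
qed

lemma spin_wave_riemann_sum:
  assumes "m > 0"
  shows "(\<lambda>L. (\<Sum>j\<in>torus L. ln (dispersion (stiffness t) (torus_momentum L j) + m)) / real L ^ 3)
    \<longlonglongrightarrow> spin_wave_integral t m"
  unfolding spin_wave_integral_def
  by (rule riemann_sum_torus[OF continuous_ln_dispersion[OF assms] ln_dispersion_bounded[OF assms]])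

subsection \<open>The spin-wave free energy\<close>

definition mean_log_dispersion :: "real \<Rightarrow> real \<Rightarrow> nat \<Rightarrow> real" where
  "mean_log_dispersion t m L
     = (\<Sum>j\<in>torus L. ln (dispersion (stiffness t) (torus_momentum L j) + m)) / real L ^ 3"

lemma log_gaussian_eq:
  assumes "L > 0"
  shows "log_gaussian t b m L / real L ^ 3 = - ln (b / (2*pi)) / 2 - mean_log_dispersion t m L / 2"
  using assms by (simp add: log_gaussian_def mean_log_dispersion_def diff_divide_distrib)

text \<open>The bounds on the partition function, taken per site; the term with
  \<open>ln (\<beta> * J / (2*pi))\<close> cancels the Gaussian normalisation. The minus sign
  exchanges the roles: the upper bound on the integral, with its free mass, bounds the free energy
  from below.\<close>

lemma restricted_free_energy_bounds:
  assumes t: "0 \<le> t" "t < 2 * pi" and d: "0 < d" "d < 1" and J: "J > 0" and \<beta>: "\<beta> > 0" and L: "L > 0"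
  shows "m > 0 \<Longrightarrow> mean_log_dispersion t m L / 2 - (12 * (\<beta> * J) * d ^ 3 + \<beta> * J * m * d\<^sup>2 / 2)
      \<le> restricted_free_energy J d \<beta> L t"
    and "restricted_free_energy J d \<beta> L t
      \<le> mean_log_dispersion t (pi\<^sup>2 / (2 * (\<beta> * J * d\<^sup>2))) L / 2 + 12 * (\<beta> * J) * d ^ 3"
proof -
  define f where "f = (\<lambda>\<theta>. exp (- \<beta> * hamiltonian J L \<theta>) * chi d t L \<theta>)"
  define Z where "Z = integral\<^sup>L (config_measure L) f"
  define m0 where "m0 = pi\<^sup>2 / (2 * (\<beta> * J * d\<^sup>2))"
  have l3: "real L ^ 3 > 0" using L by simp
  have f[measurable]: "f \<in> borel_measurable (config_measure L)"
  proof -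
    note [measurable] = hamiltonian_measurable[OF config_component_measurable, where J = J]
    have [measurable]: "(\<lambda>\<theta>. indicator (angular_window t d) (\<theta> r) :: real) \<in> borel_measurable (config_measure L)"
      if "r \<in> torus L" for r
      using config_component_measurable[OF that] by measurable
    show ?thesis unfolding f_def chi_eq_prod by measurable
  qed
  have f0: "0 \<le> f \<theta>" for \<theta> by (simp add: f_def chi_def)
  define N where "N = (\<integral>\<^sup>+\<theta>. ennreal (f \<theta>) \<partial>config_measure L)"
  have ZN: "Z = enn2real N"
    unfolding Z_def N_def by (rule integral_eq_nn_integral) (auto simp: f0)
  have up: "N \<le> ennreal (exp (real L ^ 3 * (12 * (\<beta> * J) * d ^ 3 + \<beta> * J * m * d\<^sup>2 / 2) + log_gaussian t (\<beta> * J) m L))"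
    if "m > 0" for m
    unfolding N_def f_def by (rule partition_function_upper[OF t d J \<beta> that L])
  have lo: "ennreal (exp (log_gaussian t (\<beta> * J) m0 L - real L ^ 3 * (12 * (\<beta> * J) * d ^ 3))) \<le> N"
    unfolding N_def f_def by (rule partition_function_lower[OF t d J \<beta> m0_def L])
  \<comment> \<open>Finiteness comes from the upper bound at mass 1; for an infinite
    \<open>N\<close> the value of \<open>enn2real\<close> would be 0 and the lower bound would not
    pass to \<open>Z\<close>.\<close>
  have N_fin: "N < \<infinity>" using up[of 1] by (auto intro: le_less_trans)
  have loZ: "exp (log_gaussian t (\<beta> * J) m0 L - real L ^ 3 * (12 * (\<beta> * J) * d ^ 3)) \<le> Z"
    using enn2real_mono[OF lo] N_fin by (simp add: ZN)
  have Zpos: "Z > 0" using loZ exp_gt_zero less_le_trans by blast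
  have F: "restricted_free_energy J d \<beta> L t = - ln (\<beta> * J / (2*pi)) / 2 - ln Z / real L ^ 3"
    by (simp add: restricted_free_energy_def Z_def f_def)
  have "log_gaussian t (\<beta> * J) m0 L - real L ^ 3 * (12 * (\<beta> * J) * d ^ 3) \<le> ln Z"
    using loZ Zpos by (simp add: ln_ge_iff)
  from divide_right_mono[OF this, of "real L ^ 3"] l3
  have "log_gaussian t (\<beta> * J) m0 L / real L ^ 3 - 12 * (\<beta> * J) * d ^ 3 \<le> ln Z / real L ^ 3"
    by (simp add: diff_divide_distrib)
  then show "restricted_free_energy J d \<beta> L t
      \<le> mean_log_dispersion t (pi\<^sup>2 / (2 * (\<beta> * J * d\<^sup>2))) L / 2 + 12 * (\<beta> * J) * d ^ 3"
    unfolding F log_gaussian_eq[OF L] m0_def[symmetric] by linarith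
  assume m: "m > 0"
  have "Z \<le> exp (real L ^ 3 * (12 * (\<beta> * J) * d ^ 3 + \<beta> * J * m * d\<^sup>2 / 2) + log_gaussian t (\<beta> * J) m L)"
    unfolding ZN using enn2real_mono[OF up[OF m]] by simp
  then have "ln Z \<le> real L ^ 3 * (12 * (\<beta> * J) * d ^ 3 + \<beta> * J * m * d\<^sup>2 / 2) + log_gaussian t (\<beta> * J) m L"
    using Zpos by (metis ln_exp ln_le_cancel_iff exp_gt_zero)
  from divide_right_mono[OF this, of "real L ^ 3"] l3
  have "ln Z / real L ^ 3 \<le> (12 * (\<beta> * J) * d ^ 3 + \<beta> * J * m * d\<^sup>2 / 2) + log_gaussian t (\<beta> * J) m L / real L ^ 3"
    by (simp add: add_divide_distrib)
  then show "mean_log_dispersion t m L / 2 - (12 * (\<beta> * J) * d ^ 3 + \<beta> * J * m * d\<^sup>2 / 2)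
      \<le> restricted_free_energy J d \<beta> L t"
    unfolding F log_gaussian_eq[OF L] by linarith
qed

lemma mean_log_dispersion_tendsto:
  "m > 0 \<Longrightarrow> mean_log_dispersion t m \<longlonglongrightarrow> spin_wave_integral t m"
  unfolding mean_log_dispersion_def[abs_def] by (rule spin_wave_riemann_sum)

text \<open>The error budget. From below: \<open>\<epsilon> / 4\<close> for the cubic error,
  \<open>\<epsilon> / 4\<close> for the cost of the mass, and \<open>\<epsilon> / 2\<close> for half
  the Riemann sum error. From above: the cubic error and the Riemann sum take the same shares, and
  half the mass shift takes \<open>\<epsilon> / 4\<close>.\<close>

lemma restricted_free_energy_eventually_close:
  assumes t: "0 \<le> t" "t < 2 * pi" and d: "0 < d" "d < 1" and J: "J > 0" and \<beta>: "\<beta> > 0" and \<epsilon>: "\<epsilon> > 0"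
    and d3: "12 * (\<beta> * J) * d ^ 3 \<le> \<epsilon> / 4"
    and d2: "(8 * (pi\<^sup>2 / (2 * (\<beta> * J * d\<^sup>2)))) powr (1/4) * majorant_integral \<le> \<epsilon> / 2"
  shows "\<forall>\<^sub>F L in sequentially. \<bar>restricted_free_energy J d \<beta> L t - spin_wave_free_energy t\<bar> \<le> \<epsilon>"
proof -
  \<comment> \<open>Chosen to make the cost of the mass \<open>\<epsilon> / 4\<close>. Smallness of
    \<open>m1\<close> is not at stake: a mass only raises \<open>spin_wave_integral\<close>, which
    is the favourable direction in the lower bound. By contrast \<open>m2\<close>, dictated by
    \<open>partition_function_lower\<close>, has to be small.\<close>
  define m1 where "m1 = \<epsilon> / (2 * (\<beta> * J * d\<^sup>2))"
  define m2 where "m2 = pi\<^sup>2 / (2 * (\<beta> * J * d\<^sup>2))"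
  have b: "\<beta> * J * d\<^sup>2 > 0" using \<beta> J d by simp
  have m: "m1 > 0" "m2 > 0" using b \<epsilon> by (auto simp: m1_def m2_def)
  have m1: "\<beta> * J * m1 * d\<^sup>2 / 2 = \<epsilon> / 4" using \<beta> J d by (simp add: m1_def)
  have "\<forall>\<^sub>F L in sequentially. dist (mean_log_dispersion t m1 L) (spin_wave_integral t m1) < \<epsilon>"
    using mean_log_dispersion_tendsto[OF m(1)] \<epsilon> by (rule tendstoD)
  moreover have "\<forall>\<^sub>F L in sequentially. dist (mean_log_dispersion t m2 L) (spin_wave_integral t m2) < \<epsilon>"
    using mean_log_dispersion_tendsto[OF m(2)] \<epsilon> by (rule tendstoD)
  moreover have "\<forall>\<^sub>F L in sequentially. L > 0" by (rule eventually_gt_at_top)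
  ultimately show ?thesis
  proof eventually_elim
    case (elim L)
    note lo = restricted_free_energy_bounds(1)[OF t d J \<beta> elim(3) m(1)]
      and up = restricted_free_energy_bounds(2)[OF t d J \<beta> elim(3), folded m2_def]
      and w1 = spin_wave_integral_mass(1)[OF m(1), of t]
      and w2 = spin_wave_integral_mass(2)[OF m(2), of t]
    show ?case
      using lo up w1 w2 d3 d2[folded m2_def] elim(1,2)
      unfolding m1 spin_wave_free_energy_eq dist_real_def by linarith
  qed
qed

theorem theorem4p1:
  fixes J :: real
  assumes "J > 0"
  shows "\<forall>\<epsilon>>0. \<exists>\<delta>>0. \<forall>\<beta> \<Delta>. \<beta> > 0 \<and> 0 < \<Delta> \<and> \<Delta> < 1
            \<and> (\<beta> * J) * \<Delta>\<^sup>2 \<ge> 1 / \<delta> \<and> (\<beta> * J) * \<Delta> ^ 3 \<le> \<delta> \<longrightarrow>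
           (\<forall>\<theta>s. 0 \<le> \<theta>s \<and> \<theta>s < 2 * pi \<longrightarrow>
              limsup (\<lambda>L. ereal \<bar>restricted_free_energy J \<Delta> \<beta> L \<theta>s
                                  - spin_wave_free_energy \<theta>s\<bar>) \<le> ereal \<epsilon>)"
proof (intro allI impI)
  fix \<epsilon> :: real assume \<epsilon>: "\<epsilon> > 0"
  \<comment> \<open>The target for the fourth root \<open>(8 * m) powr (1/4)\<close> in the mass
    shift, so that its product with \<open>majorant_integral\<close> is at most
    \<open>\<epsilon> / 2\<close>. The added 1 keeps the denominator positive.\<close>
  define u where "u = \<epsilon> / (2 * (\<bar>majorant_integral\<bar> + 1))"
  \<comment> \<open>The first entry makes \<open>12 * \<delta>\<close> at most
    \<open>\<epsilon> / 4\<close>. For the second, eight times the mass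
    \<open>pi\<^sup>2 / (2 * (\<beta> * J * \<Delta>\<^sup>2))\<close> is at most
    \<open>4 * pi\<^sup>2 * \<delta>\<close>, hence at most \<open>u ^ 4\<close>.\<close>
  define \<delta> where "\<delta> = min (\<epsilon> / 48) (u ^ 4 / (4 * pi\<^sup>2))"
  have u: "u > 0" using \<epsilon> by (simp add: u_def add_nonneg_pos)
  have uK: "u * majorant_integral \<le> \<epsilon> / 2"
  proof -
    have "u * majorant_integral \<le> u * (\<bar>majorant_integral\<bar> + 1)" using u by (intro mult_left_mono) auto
    also have "\<dots> = \<epsilon> / 2"
    proof -
      have "\<epsilon> / (2 * c) * c = \<epsilon> / 2" if "c \<noteq> 0" for c :: real using that by simp
      then show ?thesis unfolding u_def by (smt (verit))
    qed
    finally show ?thesis .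
  qed
  have \<delta>: "\<delta> > 0" using \<epsilon> u by (simp add: \<delta>_def)
  show "\<exists>\<delta>>0. \<forall>\<beta> \<Delta>. \<beta> > 0 \<and> 0 < \<Delta> \<and> \<Delta> < 1
            \<and> (\<beta> * J) * \<Delta>\<^sup>2 \<ge> 1 / \<delta> \<and> (\<beta> * J) * \<Delta> ^ 3 \<le> \<delta> \<longrightarrow>
           (\<forall>\<theta>s. 0 \<le> \<theta>s \<and> \<theta>s < 2 * pi \<longrightarrow>
              limsup (\<lambda>L. ereal \<bar>restricted_free_energy J \<Delta> \<beta> L \<theta>s
                                  - spin_wave_free_energy \<theta>s\<bar>) \<le> ereal \<epsilon>)"
  proof (intro exI[of _ \<delta>] conjI \<delta> allI impI; elim conjE)
    fix \<beta> \<Delta> t :: real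
    assume \<beta>: "\<beta> > 0" and d: "0 < \<Delta>" "\<Delta> < 1" and h2: "(\<beta> * J) * \<Delta>\<^sup>2 \<ge> 1 / \<delta>"
      and h3: "(\<beta> * J) * \<Delta> ^ 3 \<le> \<delta>" and t: "0 \<le> t" "t < 2 * pi"
    have b: "\<beta> * J * \<Delta>\<^sup>2 > 0" using \<beta> assms d by simp
    have "12 * (\<beta> * J) * \<Delta> ^ 3 \<le> \<epsilon> / 4" using h3 by (simp add: \<delta>_def)
    moreover have "(8 * (pi\<^sup>2 / (2 * (\<beta> * J * \<Delta>\<^sup>2)))) powr (1/4) * majorant_integral \<le> \<epsilon> / 2"
    proof -
      have "1 / (\<beta> * J * \<Delta>\<^sup>2) \<le> \<delta>" using h2 b \<delta> by (simp add: field_simps)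
      then have "4 * pi\<^sup>2 * (1 / (\<beta> * J * \<Delta>\<^sup>2)) \<le> 4 * pi\<^sup>2 * (u ^ 4 / (4 * pi\<^sup>2))"
        by (intro mult_left_mono) (auto simp: \<delta>_def)
      then have "8 * (pi\<^sup>2 / (2 * (\<beta> * J * \<Delta>\<^sup>2))) \<le> u ^ 4" by (simp add: mult_ac)
      then have "(8 * (pi\<^sup>2 / (2 * (\<beta> * J * \<Delta>\<^sup>2)))) powr (1/4) \<le> (u ^ 4) powr (1/4)"
        using \<beta> assms by (intro powr_mono2) auto
      also have "(u ^ 4) powr (1/4) = u" 
      proof -
        have "u ^ 4 = u powr 4" using powr_realpow[OF u, of 4] by simp
        then show ?thesis using u by (simp only: powr_powr) simp
      qed
      finally have le: "(8 * (pi\<^sup>2 / (2 * (\<beta> * J * \<Delta>\<^sup>2)))) powr (1/4) \<le> u" .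
      show ?thesis
      proof (cases "majorant_integral \<ge> 0")
        case True
        from mult_right_mono[OF le this] uK show ?thesis by linarith
      next
        case False
        then have "(8 * (pi\<^sup>2 / (2 * (\<beta> * J * \<Delta>\<^sup>2)))) powr (1/4) * majorant_integral \<le> 0"
          by (intro mult_nonneg_nonpos) auto
        then show ?thesis using \<epsilon> by linarith
      qed
    qed
    ultimately have "\<forall>\<^sub>F L in sequentially. \<bar>restricted_free_energy J \<Delta> \<beta> L t - spin_wave_free_energy t\<bar> \<le> \<epsilon>"
      by (rule restricted_free_energy_eventually_close[OF t d assms \<beta> \<epsilon>])
    then show "limsup (\<lambda>L. ereal \<bar>restricted_free_energy J \<Delta> \<beta> L t - spin_wave_free_energy t\<bar>) \<le> ereal \<epsilon>"
      by (intro Limsup_bounded) simp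
  qed
qed

end
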